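(* For every fixed constant $c$, \textsc{DTS} and \textsc{DTD} restricted to instances with $\delta_{\max}\le c$ admit a polynomial kernel when parameterized by $D_{\max}+|F|$.
   Context: A classification instance (CI) $E=E^+\cup E^-$ is a finite set of examples $e:F\to\mathbb{Z}$ over a common feature set $F$, partitioned into positive and negative examples. $\lambda(e,e')$ is the set of features on which $e,e'$ differ; $\delta_{\max}=\max_{e^+\in E^+,e^-\in E^-}|\lambda(e^+,e^-)|$; $D_{\max}=\max_{f\in F}|\{e(f):e\in E\}|$. A decision tree (DT) is a rooted tree whose test nodes $v$ carry a feature $f(v)$ and integer threshold $\lambda(v)$ (examples with $e(f(v))\le\lambda(v)$ go left, others right) and whose leaves are labeled positive or negative; $T$ classifies $E$ if every example reaches a leaf with its own label. Size = number of test nodes; depth = maximum number of test nodes on a root-to-leaf path. \textsc{DTS}: given $(E,s)$, is there a DT of size at most $s$ classifying $E$? \textsc{DTD}: given $(E,d)$, is there a DT of depth at most $d$ classifying $E$? A kernel is a polynomial-time algorithm mapping an instance with parameter $k$ to an equivalent instance of the same problem whose size is bounded by a function of $k$; it is polynomial if that function is a polynomial. *)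

theory Defs
  imports Main
begin

text \<open>A classification instance over the feature set F = {0..<nfeat}. An example
  e : F -> int is represented by the list [e 0, ..., e (nfeat-1)].
  pos / neg list the positive / negative examples (set semantics).\<close>

record ci =
  nfeat :: nat
  pos :: "int list list"
  neg :: "int list list"

definition examples :: "ci \<Rightarrow> int list set" where
  "examples I = set (pos I) \<union> set (neg I)"

definition wf_ci :: "ci \<Rightarrow> bool" where
  "wf_ci I \<longleftrightarrow> (\<forall>e \<in> examples I. length e = nfeat I) \<and> set (pos I) \<inter> set (neg I) = {}"

definition diff_feats :: "ci \<Rightarrow> int list \<Rightarrow> int list \<Rightarrow> nat set" where
  "diff_feats I e e' = {f. f < nfeat I \<and> e ! f \<noteq> e' ! f}"

definition delta_max :: "ci \<Rightarrow> nat" where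
  "delta_max I = Max (insert 0 {card (diff_feats I p q) | p q. p \<in> set (pos I) \<and> q \<in> set (neg I)})"

definition D_max :: "ci \<Rightarrow> nat" where
  "D_max I = Max (insert 0 {card {e ! f | e. e \<in> examples I} | f. f < nfeat I})"

definition param :: "ci \<Rightarrow> nat" where
  "param I = D_max I + nfeat I"

datatype dt = Leaf bool | Node nat int dt dt

fun dt_eval :: "dt \<Rightarrow> int list \<Rightarrow> bool" where
  "dt_eval (Leaf b) e = b"
| "dt_eval (Node f t l r) e = (if e ! f \<le> t then dt_eval l e else dt_eval r e)"

fun dt_size :: "dt \<Rightarrow> nat" where
  "dt_size (Leaf b) = 0"
| "dt_size (Node f t l r) = 1 + dt_size l + dt_size r"

fun dt_depth :: "dt \<Rightarrow> nat" where
  "dt_depth (Leaf b) = 0"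
| "dt_depth (Node f t l r) = 1 + max (dt_depth l) (dt_depth r)"

fun dt_feats :: "dt \<Rightarrow> nat set" where
  "dt_feats (Leaf b) = {}"
| "dt_feats (Node f t l r) = insert f (dt_feats l \<union> dt_feats r)"

definition classifies :: "dt \<Rightarrow> ci \<Rightarrow> bool" where
  "classifies T I \<longleftrightarrow> (\<forall>f \<in> dt_feats T. f < nfeat I)
     \<and> (\<forall>e \<in> set (pos I). dt_eval T e) \<and> (\<forall>e \<in> set (neg I). \<not> dt_eval T e)"

definition DTS :: "ci \<times> nat \<Rightarrow> bool" where
  "DTS x \<longleftrightarrow> (\<exists>T. classifies T (fst x) \<and> dt_size T \<le> snd x)"

definition DTD :: "ci \<times> nat \<Rightarrow> bool" where
  "DTD x \<longleftrightarrow> (\<exists>T. classifies T (fst x) \<and> dt_depth T \<le> snd x)"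

fun bin :: "nat \<Rightarrow> bool list" where
  "bin n = (if n = 0 then [] else odd n # bin (n div 2))"

text \<open>Self-delimiting binary encoding: each bit doubled, terminated by [False, True].\<close>
definition enc_nat :: "nat \<Rightarrow> bool list" where
  "enc_nat n = concat (map (\<lambda>b. [b, b]) (bin n)) @ [False, True]"

definition enc_int :: "int \<Rightarrow> bool list" where
  "enc_int i = (i < 0) # enc_nat (nat \<bar>i\<bar>)"

definition enc_list :: "('a \<Rightarrow> bool list) \<Rightarrow> 'a list \<Rightarrow> bool list" where
  "enc_list enc xs = enc_nat (length xs) @ concat (map enc xs)"

definition enc_inst :: "ci \<times> nat \<Rightarrow> bool list" where
  "enc_inst x = enc_nat (nfeat (fst x))
     @ enc_list (enc_list enc_int) (pos (fst x))
     @ enc_list (enc_list enc_int) (neg (fst x))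
     @ enc_nat (snd x)"

text \<open>States 0..<tm_states, symbols 0..<tm_syms; 0 is the blank symbol, symbols 1 and 2
  encode the bits False and True. State 0 is the start state, state 1 the halting state.
  Moves are -1, 0, 1.\<close>

record tm =
  tm_states :: nat
  tm_syms :: nat
  tm_delta :: "nat \<Rightarrow> nat \<Rightarrow> nat \<times> nat \<times> int"

definition wf_tm :: "tm \<Rightarrow> bool" where
  "wf_tm M \<longleftrightarrow> 2 \<le> tm_states M \<and> 3 \<le> tm_syms M \<and>
     (\<forall>q < tm_states M. \<forall>a < tm_syms M.
        case tm_delta M q a of (q', a', d) \<Rightarrow>
          q' < tm_states M \<and> a' < tm_syms M \<and> d \<in> {-1, 0, 1})"

type_synonym config = "nat \<times> (int \<Rightarrow> nat) \<times> int"

definition bit_sym :: "bool \<Rightarrow> nat" where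
  "bit_sym b = (if b then 2 else 1)"

definition tm_step :: "tm \<Rightarrow> config \<Rightarrow> config" where
  "tm_step M c = (case c of (q, tp, h) \<Rightarrow>
     if q = 1 then (q, tp, h)
     else (case tm_delta M q (tp h) of (q', a', d) \<Rightarrow> (q', tp(h := a'), h + d)))"

definition tm_run :: "tm \<Rightarrow> nat \<Rightarrow> config \<Rightarrow> config" where
  "tm_run M t = (tm_step M ^^ t)"

definition tm_init :: "bool list \<Rightarrow> config" where
  "tm_init w = (0, (\<lambda>i. if 0 \<le> i \<and> i < int (length w) then bit_sym (w ! nat i) else 0), 0)"

definition tm_output :: "config \<Rightarrow> nat list" where
  "tm_output c = (case c of (q, tp, h) \<Rightarrow>
     map (\<lambda>i. tp (h + int i)) [0..<(LEAST m. tp (h + int m) = 0)])"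

definition tm_computes_within :: "tm \<Rightarrow> bool list \<Rightarrow> bool list \<Rightarrow> nat \<Rightarrow> bool" where
  "tm_computes_within M w v t \<longleftrightarrow>
     fst (tm_run M t (tm_init w)) = 1 \<and> tm_output (tm_run M t (tm_init w)) = map bit_sym v"

definition has_poly_kernel ::
    "(ci \<times> nat \<Rightarrow> bool) \<Rightarrow> (ci \<Rightarrow> bool) \<Rightarrow> (ci \<Rightarrow> nat) \<Rightarrow> bool" where
  "has_poly_kernel P R k \<longleftrightarrow>
     (\<exists>M a b c d. wf_tm M \<and>
        (\<forall>x. wf_ci (fst x) \<and> R (fst x) \<longrightarrow>
           (\<exists>y t. tm_computes_within M (enc_inst x) (enc_inst y) t
              \<and> t \<le> a * length (enc_inst x) ^ b + a
              \<and> wf_ci (fst y) \<and> R (fst y)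
              \<and> (P y \<longleftrightarrow> P x)
              \<and> length (enc_inst y) \<le> c * k (fst x) ^ d + c)))"

end

theory Submission
  imports Defs
begin

text \<open>If one class of examples is empty, the instance is trivial. Otherwise all positive examples
  lie within Hamming distance \<open>c\<close> of any fixed negative one and vice versa, so with \<open>F\<close> features and
  at most \<open>D\<close> values per feature each class has at most \<open>(1 + F * D) ^ c\<close> distinct examples. After
  removing duplicates, entries matter only through their order and may be replaced by their ranks.
  Any consistent instance with \<open>n\<close> positive examples has a decision tree of depth at most
  \<open>2 * F * n\<close>, hence of size at most \<open>2 ^ (2 * F * n)\<close>, so larger budgets can be cut down to a
  number with polynomially many bits.

  To see that this is computable by a Turing machine in polynomial time, structured data are coded
  as binary trees in preorder on a stack; the functions computed by polynomial-time stack programs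
  are closed under pairing, composition, case distinction and loops with polynomially bounded state,
  and a stack program is simulated on a single tape with one track per stack.\<close>

section \<open>Turing machines from finite controls\<close>

type_synonym ('q, 's) transition = "'q \<Rightarrow> 's \<Rightarrow> 'q \<times> 's \<times> int"
type_synonym ('q, 's) conf = "'q \<times> (int \<Rightarrow> 's) \<times> int"

definition conf_step :: "('q, 's) transition \<Rightarrow> ('q, 's) conf \<Rightarrow> ('q, 's) conf" where
  "conf_step \<delta> = (\<lambda>(q, tp, h). case \<delta> q (tp h) of (q', a, d) \<Rightarrow> (q', tp(h := a), h + d))"

definition index :: "'a list \<Rightarrow> 'a \<Rightarrow> nat" where
  "index xs = inv_into {..<length xs} ((!) xs)"

lemma index_nth: "distinct xs \<Longrightarrow> i < length xs \<Longrightarrow> index xs (xs ! i) = i"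
  unfolding index_def by (rule inv_into_f_f) (auto simp: inj_on_nth)

lemma
  assumes "x \<in> set xs"
  shows index_less_length: "index xs x < length xs" and nth_index: "xs ! index xs x = x"
proof -
  have in_image: "x \<in> (!) xs ` {..<length xs}"
    using assms by (auto simp: in_set_conv_nth)
  show "index xs x < length xs"
    using inv_into_into[OF in_image] by (simp add: index_def)
  show "xs ! index xs x = x"
    unfolding index_def by (rule f_inv_into_f[OF in_image])
qed

definition input_tape :: "'s list \<Rightarrow> bool list \<Rightarrow> int \<Rightarrow> 's" where
  "input_tape ss w = (\<lambda>i. if 0 \<le> i \<and> i < int (length w) then ss ! bit_sym (w ! nat i) else ss ! 0)"

locale enumerated_control =
  fixes \<delta> :: "('q, 's) transition" and qs :: "'q list" and ss :: "'s list"
  assumes distinct_states: "distinct qs" and length_states: "2 \<le> length qs"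
    and distinct_syms: "distinct ss" and length_syms: "3 \<le> length ss" and set_syms: "set ss = UNIV"
    and closed: "q \<in> set qs \<Longrightarrow> fst (\<delta> q a) \<in> set qs"
    and move: "snd (snd (\<delta> q a)) \<in> {-1, 0, 1}"
    and halt: "\<delta> (qs ! 1) a = (qs ! 1, a, 0)"
begin

definition machine :: tm where
  "machine = \<lparr>tm_states = length qs, tm_syms = length ss,
     tm_delta = (\<lambda>q a. case \<delta> (qs ! q) (ss ! a) of (q', b, d) \<Rightarrow> (index qs q', index ss b, d))\<rparr>"

definition machine_conf :: "('q, 's) conf \<Rightarrow> config" where
  "machine_conf = (\<lambda>(q, tp, h). (index qs q, index ss \<circ> tp, h))"

lemma start_in_states: "qs ! 0 \<in> set qs"
  using length_states by (intro nth_mem) linarith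

lemma index_state: "i < 2 \<Longrightarrow> index qs (qs ! i) = i"
  using index_nth[OF distinct_states] length_states by simp

lemma index_sym: "i < 3 \<Longrightarrow> index ss (ss ! i) = i"
  using index_nth[OF distinct_syms] length_syms by simp

lemma wf_machine: "wf_tm machine"
  unfolding wf_tm_def
proof (intro conjI allI impI)
  show "2 \<le> tm_states machine" "3 \<le> tm_syms machine"
    using length_states length_syms by (simp_all add: machine_def)
  fix q a assume "q < tm_states machine" "a < tm_syms machine"
  then have "qs ! q \<in> set qs" by (simp add: machine_def)
  then show "case tm_delta machine q a of (q', a', d) \<Rightarrow>
      q' < tm_states machine \<and> a' < tm_syms machine \<and> d \<in> {-1, 0, 1}"
    using closed[of "qs ! q" "ss ! a"] move[of "qs ! q" "ss ! a"]
    by (auto simp: machine_def set_syms index_less_length split: prod.split)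
qed

lemma fst_conf_step: "fst x \<in> set qs \<Longrightarrow> fst (conf_step \<delta> x) \<in> set qs"
  using closed[of "fst x" "fst (snd x) (snd (snd x))"]
  by (auto simp: conf_step_def split: prod.splits)

lemma tm_step_machine_conf:
  assumes "fst x \<in> set qs"
  shows "tm_step machine (machine_conf x) = machine_conf (conf_step \<delta> x)"
proof -
  obtain q tp h where x_eq: "x = (q, tp, h)" by (rule prod_cases3)
  show ?thesis
  proof (cases "q = qs ! 1")
    case True
    then show ?thesis
      using halt[of "tp h"] index_state[of 1]
      by (simp add: x_eq machine_conf_def tm_step_def conf_step_def)
  next
    case False
    then have "index qs q \<noteq> 1"
      using nth_index[of q qs] assms by (auto simp: x_eq)
    then show ?thesis
      using assms
      by (auto simp: x_eq machine_conf_def tm_step_def conf_step_def machine_def nth_index set_syms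
          split: prod.split)
  qed
qed

lemma tm_run_machine_conf:
  assumes "fst x \<in> set qs"
  shows "tm_run machine t (machine_conf x) = machine_conf ((conf_step \<delta> ^^ t) x)"
proof -
  have "fst ((conf_step \<delta> ^^ t) x) \<in> set qs" for t
    using assms fst_conf_step by (induction t) auto
  then show ?thesis
    by (induction t) (simp_all add: tm_run_def tm_step_machine_conf)
qed

lemma tm_init_eq: "tm_init w = machine_conf (qs ! 0, input_tape ss w, 0)"
  by (auto simp: tm_init_def machine_conf_def input_tape_def index_state index_sym bit_sym_def)

lemma tm_computes_within_machine:
  assumes "(conf_step \<delta> ^^ t) (qs ! 0, input_tape ss w, 0) = (qs ! 1, input_tape ss v, 0)"
  shows "tm_computes_within machine w v t"
proof -
  have run: "tm_run machine t (tm_init w) = (1, index ss \<circ> input_tape ss v, 0)"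
    using assms tm_run_machine_conf[of "(qs ! 0, input_tape ss w, 0)" t] start_in_states
      index_state[of 1]
    by (simp add: tm_init_eq machine_conf_def)
  have sym: "index ss (input_tape ss v (int i)) = (if i < length v then bit_sym (v ! i) else 0)"
      for i
    by (simp add: input_tape_def index_sym bit_sym_def)
  have "(LEAST i. index ss (input_tape ss v (int i)) = 0) = length v"
    by (rule Least_equality) (auto simp: sym bit_sym_def split: if_splits intro: leI)
  then show ?thesis
    by (auto simp: tm_computes_within_def run tm_output_def sym intro!: nth_equalityI)
qed

end

lemma finite_distinct_list_extend:
  assumes "finite A" "distinct ys" "set ys \<subseteq> A"
  obtains zs where "distinct (ys @ zs)" "set (ys @ zs) = A"
proof -
  obtain zs where "distinct zs" "set zs = A - set ys"
    using finite_distinct_list[of "A - set ys"] assms(1) by auto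
  then show ?thesis using that[of zs] assms by auto
qed

section \<open>Stack programs\<close>

datatype 'i prog =
    Skip
  | Push 'i bool
  | Pop 'i
  | Seq "'i prog" "'i prog" (infixl ";;" 60)
  | Cond 'i "bool option \<Rightarrow> bool" "'i prog" "'i prog"
  | While 'i "bool option \<Rightarrow> bool" "'i prog"

type_synonym 'i store = "'i \<Rightarrow> bool list"

primrec peek :: "'a list \<Rightarrow> 'a option" where
  "peek [] = None"
| "peek (x # xs) = Some x"

inductive runs :: "'i prog \<Rightarrow> 'i store \<Rightarrow> nat \<Rightarrow> 'i store \<Rightarrow> bool" where
  runs_Skip: "runs Skip s 1 s"
| runs_Push: "runs (Push i b) s 1 (s(i := b # s i))"
| runs_Pop: "runs (Pop i) s 1 (s(i := tl (s i)))"
| runs_Seq: "runs c s t s' \<Longrightarrow> runs d s' u s'' \<Longrightarrow> runs (c ;; d) s (t + u + 1) s''"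
| runs_Cond: "runs (if P (peek (s i)) then c else d) s t s' \<Longrightarrow> runs (Cond i P c d) s (t + 1) s'"
| runs_While_False: "\<not> P (peek (s i)) \<Longrightarrow> runs (While i P c) s 1 s"
| runs_While_True: "P (peek (s i)) \<Longrightarrow> runs c s t s' \<Longrightarrow> runs (While i P c) s' u s''
    \<Longrightarrow> runs (While i P c) s (t + u + 1) s''"
| runs_mono: "runs c s t s' \<Longrightarrow> t \<le> u \<Longrightarrow> runs c s u s'"

lemma length_runs: "runs c s t s' \<Longrightarrow> length (s' j) \<le> length (s j) + t"
proof (induction rule: runs.induct)
  case (runs_Seq c s t s' d u s'')
  then show ?case by linarith
next
  case (runs_While_True P s i c t s' u s'')
  then show ?case by linarith
qed auto

subsection \<open>Simulation by a finite control\<close>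

text \<open>Every stack occupies one track of the tape, with its bottom at position 0. Between two
  commands the head rests at position -1. A command on stack \<open>i\<close> sends it up to the first blank
  cell of track \<open>i\<close>; as no cell below the top of that stack is entirely blank, the head finds its
  way back by moving left to the first entirely blank cell. Besides the phase of this movement, the
  control remembers the list of commands still to be executed; \<open>conts c k\<close> contains the lists that
  arise from running \<open>c\<close> in front of \<open>k\<close>.\<close>

type_synonym 'i symbol = "'i \<Rightarrow> bool option"

definition tape_of :: "'i store \<Rightarrow> int \<Rightarrow> 'i symbol" where
  "tape_of s p = (\<lambda>i. if 0 \<le> p \<and> p < int (length (s i)) then Some (rev (s i) ! nat p) else None)"

datatype phase = Start | Home | Up | Top | Back | Halt

lemma UNIV_phase: "UNIV = {Start, Home, Up, Top, Back, Halt}"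
  using phase.exhaust by auto

primrec stack_of :: "'i prog \<Rightarrow> 'i" where
  "stack_of Skip = undefined"
| "stack_of (Push i b) = i"
| "stack_of (Pop i) = i"
| "stack_of (c ;; d) = undefined"
| "stack_of (Cond i P c d) = i"
| "stack_of (While i P c) = i"

fun control :: "(phase \<times> 'i prog list, 'i symbol) transition" where
  "control (Start, k) a = ((Home, k), a, -1)"
| "control (Home, []) a = ((Halt, []), a, 1)"
| "control (Home, c # k) a = (case c of
     Skip \<Rightarrow> ((Home, k), a, 0)
   | c\<^sub>1 ;; c\<^sub>2 \<Rightarrow> ((Home, c\<^sub>1 # c\<^sub>2 # k), a, 0)
   | _ \<Rightarrow> ((Up, c # k), a, 1))"
| "control (Up, c # k) a = (if a (stack_of c) \<noteq> None then ((Up, c # k), a, 1) else case c of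
     Push i b \<Rightarrow> ((Back, k), a(i := Some b), 0)
   | _ \<Rightarrow> ((Top, c # k), a, -1))"
| "control (Top, c # k) a = (case c of
     Pop i \<Rightarrow> ((Back, k), a(i := None), if a i = None then 0 else -1)
   | Cond i P c\<^sub>1 c\<^sub>2 \<Rightarrow> ((Back, (if P (a i) then c\<^sub>1 else c\<^sub>2) # k), a, 0)
   | While i P b \<Rightarrow> ((Back, if P (a i) then b # c # k else k), a, 0)
   | _ \<Rightarrow> ((Halt, []), a, 0))"
| "control (Back, k) a = (if a = (\<lambda>_. None) then ((Home, k), a, 0) else ((Back, k), a, -1))"
| "control (_, _) a = ((Halt, []), a, 0)"

primrec conts :: "'i prog \<Rightarrow> 'i prog list \<Rightarrow> 'i prog list set" where
  "conts Skip k = {Skip # k}"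
| "conts (Push i b) k = {Push i b # k}"
| "conts (Pop i) k = {Pop i # k}"
| "conts (c ;; d) k = insert ((c ;; d) # k) (conts c (d # k) \<union> conts d k)"
| "conts (Cond i P c d) k = insert (Cond i P c d # k) (conts c k \<union> conts d k)"
| "conts (While i P c) k = insert (While i P c # k) (conts c (While i P c # k))"

lemma finite_conts: "finite (conts c k)"
  by (induction c arbitrary: k) auto

lemma Cons_in_conts: "c # k \<in> conts c k"
  by (cases c) auto

lemma control_Nil: "snd (fst (control (ph, []) a)) = []"
  by (cases ph) auto

lemma control_conts:
  "l \<in> conts c k \<Longrightarrow> snd (fst (control (ph, l) a)) \<in> {[], k} \<union> conts c k"
proof (induction c arbitrary: k)
  case (Seq c d)
  consider "l = (c ;; d) # k" | "l \<in> conts c (d # k)" | "l \<in> conts d k"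
    using Seq.prems by auto
  then show ?case
  proof cases
    assume "l = (c ;; d) # k"
    then show ?thesis using Cons_in_conts[of c "d # k"] by (cases ph) auto
  qed (use Seq.IH Cons_in_conts[of d k] in fastforce)+
next
  case (Cond i P c d)
  consider "l = Cond i P c d # k" | "l \<in> conts c k" | "l \<in> conts d k"
    using Cond.prems by auto
  then show ?case
  proof cases
    assume "l = Cond i P c d # k"
    then show ?thesis using Cons_in_conts[of c k] Cons_in_conts[of d k] by (cases ph) auto
  qed (use Cond.IH in fastforce)+
next
  case (While i P c)
  consider "l = While i P c # k" | "l \<in> conts c (While i P c # k)"
    using While.prems by auto
  then show ?case
  proof cases
    assume "l = While i P c # k"
    then show ?thesis using Cons_in_conts[of c "While i P c # k"] by (cases ph) auto
  qed (use While.IH in fastforce)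
qed (cases ph; auto)+

lemma control_move: "snd (snd (control q a)) \<in> {-1, 0, 1}"
  by (cases "(q, a)" rule: control.cases) (auto split: prog.split)

definition reaches ::
    "(phase \<times> 'i prog list, 'i symbol) conf \<Rightarrow> nat \<Rightarrow> (phase \<times> 'i prog list, 'i symbol) conf
      \<Rightarrow> bool" where
  "reaches x n y \<longleftrightarrow> (\<exists>m\<le>n. (conf_step control ^^ m) x = y)"

lemma reaches_refl: "reaches x 0 x"
  by (simp add: reaches_def)

lemma reaches_mono: "reaches x m y \<Longrightarrow> m \<le> n \<Longrightarrow> reaches x n y"
  by (auto simp: reaches_def intro: le_trans)

lemma reaches_trans [trans]:
  assumes "reaches x m y" "reaches y n z"
  shows "reaches x (m + n) z"
proof -
  obtain m' n' where "m' \<le> m" "n' \<le> n" "(conf_step control ^^ (n' + m')) x = z"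
    using assms by (auto simp: reaches_def funpow_add)
  then show ?thesis
    unfolding reaches_def by (intro exI[of _ "n' + m'"]) simp
qed

lemma reaches_step: "conf_step control x = y \<Longrightarrow> reaches x 1 y"
  unfolding reaches_def by (rule exI[of _ 1]) simp

abbreviation home :: "'i prog list \<Rightarrow> 'i store \<Rightarrow> (phase \<times> 'i prog list, 'i symbol) conf" where
  "home k s \<equiv> ((Home, k), tape_of s, -1)"

lemma reaches_up:
  fixes s :: "'i store" and c :: "'i prog"
  defines "l \<equiv> length (s (stack_of c))"
  assumes "p \<le> int l" "0 \<le> p"
  shows "reaches ((Up, c # k), tape_of s, p) l ((Up, c # k), tape_of s, int l)"
proof -
  have "reaches ((Up, c # k), tape_of s, int l - int n) n ((Up, c # k), tape_of s, int l)"
    if "n \<le> l" for n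
    using that
  proof (induction n)
    case (Suc n)
    have "tape_of s (int l - int (Suc n)) (stack_of c) \<noteq> None"
      using Suc.prems by (simp add: tape_of_def l_def)
    then have "reaches ((Up, c # k), tape_of s, int l - int (Suc n)) 1
        ((Up, c # k), tape_of s, int l - int n)"
      by (intro reaches_step) (simp add: conf_step_def)
    also have "reaches \<dots> n ((Up, c # k), tape_of s, int l)"
      using Suc by simp
    finally show ?case by simp
  qed (simp add: reaches_refl)
  from reaches_mono[OF this[of "nat (int l - p)"], of l] assms show ?thesis
    by simp
qed

lemma reaches_home:
  assumes "- 1 \<le> p" "p < int (length (s i))"
  shows "reaches ((Back, k), tape_of s, p) (length (s i) + 1) (home k s)"
proof -
  have "reaches ((Back, k), tape_of s, int n - 1) (n + 1) (home k s)"
    if "n \<le> length (s i)" for n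
    using that
  proof (induction n)
    case 0
    show ?case by (rule reaches_mono[OF reaches_step]) (auto simp: conf_step_def tape_of_def)
  next
    case (Suc n)
    have "tape_of s (int n) \<noteq> (\<lambda>_. None)"
      using Suc.prems by (auto simp: tape_of_def fun_eq_iff intro!: exI[of _ i])
    then have "reaches ((Back, k), tape_of s, int (Suc n) - 1) 1 ((Back, k), tape_of s, int n - 1)"
      by (intro reaches_step) (simp add: conf_step_def)
    also have "reaches \<dots> (n + 1) (home k s)"
      using Suc by simp
    finally show ?case by simp
  qed
  from reaches_mono[OF this[of "nat (p + 1)"], of "length (s i) + 1"] assms show ?thesis
    by simp
qed

lemma tape_of_push:
  "(tape_of s)(int (length (s i)) := (tape_of s (int (length (s i))))(i := Some b))
    = tape_of (s(i := b # s i))"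
  by (rule ext) (auto simp: tape_of_def nth_append fun_eq_iff)

lemma tape_of_pop:
  "(tape_of s)(int (length (s i)) - 1 := (tape_of s (int (length (s i)) - 1))(i := None))
    = tape_of (s(i := tl (s i)))"
  by (cases "s i"; rule ext) (auto simp: tape_of_def nth_append fun_eq_iff)

lemma tape_of_top: "tape_of s (int (length (s i)) - 1) i = peek (s i)"
  by (cases "s i") (auto simp: tape_of_def nth_append)

lemma reaches_Seq: "reaches (home ((c ;; d) # k) s) 1 (home (c # d # k) s)"
  by (rule reaches_step) (simp add: conf_step_def)

lemma reaches_Push:
  "reaches (home (Push i b # k) s) (2 * length (s i) + 4) (home k (s(i := b # s i)))"
proof -
  let ?s = "s(i := b # s i)" and ?l = "length (s i)"
  have "reaches (home (Push i b # k) s) 1 ((Up, Push i b # k), tape_of s, 0)"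
    by (rule reaches_step) (simp add: conf_step_def)
  also have "reaches \<dots> ?l ((Up, Push i b # k), tape_of s, int ?l)"
    using reaches_up[of 0 s "Push i b"] by simp
  also have "reaches \<dots> 1 ((Back, k), tape_of ?s, int ?l)"
    by (rule reaches_step) (simp add: conf_step_def tape_of_push[symmetric], simp add: tape_of_def)
  also have "reaches \<dots> (?l + 2) (home k ?s)"
    using reaches_home[of "int ?l" ?s i k] by simp
  finally show ?thesis by (rule reaches_mono) simp
qed

lemma reaches_Top:
  assumes "c \<in> {Pop i, Cond i P d d', While i P d}"
  shows "reaches (home (c # k) s) (length (s i) + 2)
      ((Top, c # k), tape_of s, int (length (s i)) - 1)"
proof -
  let ?l = "length (s i)"
  have stack: "stack_of c = i" using assms by auto
  have "reaches (home (c # k) s) 1 ((Up, c # k), tape_of s, 0)"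
    using assms by (intro reaches_step) (auto simp: conf_step_def)
  also have "reaches \<dots> ?l ((Up, c # k), tape_of s, int ?l)"
    using reaches_up[of 0 s c] by (simp add: stack)
  also have "tape_of s (int ?l) i = None"
    by (simp add: tape_of_def)
  then have "reaches ((Up, c # k), tape_of s, int ?l) 1 ((Top, c # k), tape_of s, int ?l - 1)"
    using assms by (intro reaches_step) (auto simp: conf_step_def)
  finally show ?thesis by simp
qed

lemma reaches_Pop:
  "reaches (home (Pop i # k) s) (2 * length (s i) + 4) (home k (s(i := tl (s i))))"
proof -
  let ?s = "s(i := tl (s i))" and ?l = "length (s i)"
  define p where "p = (if s i = [] then -1 else int ?l - 2)"
  have "reaches (home (Pop i # k) s) (?l + 2) ((Top, Pop i # k), tape_of s, int ?l - 1)"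
    by (rule reaches_Top) simp
  also have "reaches \<dots> 1 ((Back, k), tape_of ?s, p)"
    using tape_of_pop[of s i] tape_of_top[of s i]
    by (intro reaches_step) (cases "s i"; simp add: conf_step_def p_def)
  also have "reaches \<dots> (?l + 1) (home k ?s)"
    by (rule reaches_mono[OF reaches_home[where i = i]]) (cases "s i"; simp add: p_def)+
  finally show ?thesis by (rule reaches_mono) simp
qed

lemma reaches_branch:
  fixes s :: "'i store" and i :: 'i
  defines "l \<equiv> length (s i)"
  assumes "c \<in> {Cond i P d d', While i P d}"
    and "control (Top, c # k) (tape_of s (int l - 1)) = ((Back, k'), tape_of s (int l - 1), 0)"
  shows "reaches (home (c # k) s) (2 * l + 4) (home k' s)"
proof -
  have "reaches (home (c # k) s) (l + 2) ((Top, c # k), tape_of s, int l - 1)"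
    unfolding l_def by (rule reaches_Top[of c i P d d']) (use assms(2) in auto)
  also have "reaches \<dots> 1 ((Back, k'), tape_of s, int l - 1)"
    using assms(3) by (intro reaches_step) (simp add: conf_step_def)
  also have "reaches \<dots> (l + 1) (home k' s)"
    unfolding l_def by (rule reaches_home) simp_all
  finally show ?thesis by (rule reaches_mono) simp
qed

lemma reaches_Cond:
  "reaches (home (Cond i P c d # k) s) (2 * length (s i) + 4)
     (home ((if P (peek (s i)) then c else d) # k) s)"
  by (rule reaches_branch[of _ i P c d]) (auto simp: tape_of_top)

lemma reaches_While:
  "reaches (home (While i P c # k) s) (2 * length (s i) + 4)
     (home (if P (peek (s i)) then c # While i P c # k else k) s)"
  by (rule reaches_branch[of _ i P c c]) (auto simp: tape_of_top)

lemma length_runs_le: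
  assumes "runs c s t s'" "\<And>i. length (s i) + (t + u + 1) \<le> B"
  shows "length (s i) + t \<le> B" "length (s' i) + u \<le> B"
  using assms(2)[of i] length_runs[OF assms(1), of i] by simp_all

lemma reaches_if_runs:
  assumes "runs c s t s'" "\<And>i. length (s i) + t \<le> B"
  shows "reaches (home (c # k) s) (t * (2 * B + 4)) (home k s')"
  using assms
proof (induction arbitrary: k rule: runs.induct)
  case (runs_Skip s)
  show ?case by (rule reaches_mono[OF reaches_step]) (auto simp: conf_step_def)
next
  case (runs_Push i b s)
  show ?case using runs_Push[of i] by (intro reaches_mono[OF reaches_Push]) simp
next
  case (runs_Pop i s)
  show ?case using runs_Pop[of i] by (intro reaches_mono[OF reaches_Pop]) simp
next
  case (runs_Seq c s t s' d u s'')
  note bounds = length_runs_le[OF runs_Seq.hyps(1) runs_Seq.prems]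
  note reaches_Seq
  also note runs_Seq.IH(1)[OF bounds(1)]
  also note runs_Seq.IH(2)[OF bounds(2)]
  finally show ?case by (rule reaches_mono) (simp add: algebra_simps)
next
  case (runs_Cond P s i c d t s')
  have "length (s j) + t \<le> B" for j using runs_Cond.prems[of j] by simp
  from reaches_trans[OF reaches_Cond[where P = P] runs_Cond.IH[OF this]]
  show ?case by (rule reaches_mono) (use runs_Cond.prems[of i] in simp)
next
  case (runs_While_False P s i c)
  show ?case
    using reaches_mono[OF reaches_While[of i P c k s]] runs_While_False.hyps
      runs_While_False.prems[of i]
    by simp
next
  case (runs_While_True P s i c t s' u s'')
  note bounds = length_runs_le[OF runs_While_True.hyps(2) runs_While_True.prems]
  have "reaches (home (While i P c # k) s) (2 * length (s i) + 4) (home (c # While i P c # k) s)"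
    using reaches_While[of i P c k s] runs_While_True.hyps(1) by simp
  also note runs_While_True.IH(1)[OF bounds(1)]
  also note runs_While_True.IH(2)[OF bounds(2)]
  finally show ?case
    by (rule reaches_mono) (use runs_While_True.prems[of i] in \<open>simp add: algebra_simps\<close>)
next
  case (runs_mono c s t s' u)
  then have "length (s i) + t \<le> B" for i by (meson add_left_mono le_trans)
  from runs_mono.IH[OF this] show ?case
    by (rule reaches_mono) (use runs_mono.hyps in simp)
qed

definition io_store :: "'i \<Rightarrow> bool list \<Rightarrow> 'i store" where
  "io_store i w = (\<lambda>_. [])(i := rev w)"

lemma reaches_Halt:
  assumes "runs c (io_store i w) t (io_store i v)"
  shows "reaches ((Start, [c]), tape_of (io_store i w), 0) (t * (2 * (length w + t) + 4) + 2)
    ((Halt, []), tape_of (io_store i v), 0)"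
proof -
  have "reaches ((Start, [c]), tape_of (io_store i w), 0) 1 (home [c] (io_store i w))"
    by (rule reaches_step) (simp add: conf_step_def)
  also have "reaches \<dots> (t * (2 * (length w + t) + 4)) (home [] (io_store i v))"
    by (rule reaches_if_runs[OF assms]) (simp add: io_store_def)
  also have "reaches \<dots> 1 ((Halt, []), tape_of (io_store i v), 0)"
    by (rule reaches_step) (simp add: conf_step_def)
  finally show ?thesis by simp
qed

lemma obtain_states:
  obtains qs where "distinct qs" "2 \<le> length qs" "qs ! 0 = (Start, [c])" "qs ! 1 = (Halt, [])"
    "\<And>q a. q \<in> set qs \<Longrightarrow> fst (control q a) \<in> set qs"
proof -
  define states where "states = (UNIV :: phase set) \<times> insert [] (conts c [])"
  have "finite states" "distinct [(Start, [c]), (Halt, [])]"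
    "set [(Start, [c]), (Halt, [])] \<subseteq> states"
    using Cons_in_conts[of c "[]"] by (auto simp: states_def finite_conts UNIV_phase)
  then obtain qs where qs: "distinct ([(Start, [c]), (Halt, [])] @ qs)"
      "set ([(Start, [c]), (Halt, [])] @ qs) = states"
    by (rule finite_distinct_list_extend)
  have "fst (control q a) \<in> states" if "q \<in> states" for q a
  proof -
    obtain ph l where q_eq: "q = (ph, l)" by (cases q)
    have "snd (fst (control q a)) \<in> insert [] (conts c [])"
      using that control_Nil[of ph a] control_conts[of l c "[]" ph a]
        by (auto simp: q_eq states_def)
    then show ?thesis by (simp add: states_def mem_Times_iff)
  qed
  then show thesis
    using qs by (intro that[of "[(Start, [c]), (Halt, [])] @ qs"])
      (simp_all only: nth_append, simp_all)
qed

lemma obtain_symbols: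
  fixes i :: "'i::finite"
  obtains ss where "distinct ss" "3 \<le> length ss" "set ss = UNIV"
    "\<And>w. input_tape ss w = tape_of (io_store i w)"
proof -
  define sym :: "bool option \<Rightarrow> 'i symbol" where "sym x = (\<lambda>_. None)(i := x)" for x
  let ?bits = "[sym None, sym (Some False), sym (Some True)]"
  have "distinct ?bits" "set ?bits \<subseteq> UNIV"
    by (auto simp: sym_def fun_eq_iff)
  with finite obtain ss where ss: "distinct (?bits @ ss)" "set (?bits @ ss) = UNIV"
    by (rule finite_distinct_list_extend)
  have "input_tape (?bits @ ss) w = tape_of (io_store i w)" for w
    by (rule ext)
      (auto simp: input_tape_def tape_of_def io_store_def sym_def bit_sym_def fun_eq_iff)
  then show thesis by (intro that[OF ss(1) _ ss(2)]) simp_all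
qed

theorem tm_computes_if_runs:
  fixes c :: "'i::finite prog"
  obtains M where "wf_tm M"
    "\<And>w v t. runs c (io_store i w) t (io_store i v) \<Longrightarrow>
       \<exists>u \<le> t * (2 * (length w + t) + 4) + 2. tm_computes_within M w v u"
proof -
  obtain qs where qs: "distinct qs" "2 \<le> length qs" "qs ! 0 = (Start, [c])" "qs ! 1 = (Halt, [])"
    "\<And>q a. q \<in> set qs \<Longrightarrow> fst (control q a) \<in> set qs"
    using obtain_states[of c] by blast
  obtain ss where ss: "distinct ss" "3 \<le> length ss" "set ss = UNIV"
    "\<And>w. input_tape ss w = tape_of (io_store i w)"
    using obtain_symbols[of i] by blast
  interpret enumerated_control control qs ss
    by standard (simp_all only: qs ss control_move control.simps)
  have "\<exists>u \<le> t * (2 * (length w + t) + 4) + 2. tm_computes_within machine w v u"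
    if "runs c (io_store i w) t (io_store i v)" for w v t
    using reaches_Halt[OF that] tm_computes_within_machine unfolding reaches_def qs ss by blast
  with wf_machine that show thesis by blast
qed

section \<open>Polynomially bounded running times\<close>

definition polybounded :: "'a set \<Rightarrow> ('a \<Rightarrow> nat) \<Rightarrow> ('a \<Rightarrow> nat) \<Rightarrow> bool" where
  "polybounded X f n \<longleftrightarrow> (\<exists>a b. \<forall>x\<in>X. f x \<le> a * Suc (n x) ^ b)"

named_theorems polybounded_intros

lemma polybounded_mono: "polybounded X g n \<Longrightarrow> (\<And>x. x \<in> X \<Longrightarrow> f x \<le> g x) \<Longrightarrow> polybounded X f n"
  unfolding polybounded_def by (meson le_trans)

lemma polybounded_const [polybounded_intros]: "polybounded X (\<lambda>_. k) n"
  unfolding polybounded_def by (rule exI[of _ k], rule exI[of _ 0]) simp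

lemma polybounded_self [polybounded_intros]: "polybounded X n n"
  unfolding polybounded_def by (rule exI[of _ 1], rule exI[of _ 1]) simp

lemma polybounded_add [polybounded_intros]:
  assumes "polybounded X f n" "polybounded X g n"
  shows "polybounded X (\<lambda>x. f x + g x) n"
proof -
  obtain a b a' b' where bound_f: "\<And>x. x \<in> X \<Longrightarrow> f x \<le> a * Suc (n x) ^ b"
    and bound_g: "\<And>x. x \<in> X \<Longrightarrow> g x \<le> a' * Suc (n x) ^ b'"
    using assms unfolding polybounded_def by blast
  have "f x + g x \<le> (a + a') * Suc (n x) ^ (b + b')" if "x \<in> X" for x
  proof -
    have "f x + g x \<le> a * Suc (n x) ^ (b + b') + a' * Suc (n x) ^ (b + b')"
      by (intro add_mono order.trans[OF bound_f[OF that]] order.trans[OF bound_g[OF that]]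
          mult_le_mono2 power_increasing) auto
    then show ?thesis by (simp only: distrib_right)
  qed
  then show ?thesis unfolding polybounded_def by blast
qed

lemma polybounded_mult [polybounded_intros]:
  assumes "polybounded X f n" "polybounded X g n"
  shows "polybounded X (\<lambda>x. f x * g x) n"
proof -
  obtain a b a' b' where bound_f: "\<And>x. x \<in> X \<Longrightarrow> f x \<le> a * Suc (n x) ^ b"
    and bound_g: "\<And>x. x \<in> X \<Longrightarrow> g x \<le> a' * Suc (n x) ^ b'"
    using assms unfolding polybounded_def by blast
  have "f x * g x \<le> (a * a') * Suc (n x) ^ (b + b')" if "x \<in> X" for x
    using mult_le_mono[OF bound_f[OF that] bound_g[OF that]] by (simp only: power_add ac_simps)
  then show ?thesis unfolding polybounded_def by blast
qed

lemma polybounded_Suc [polybounded_intros]: "polybounded X f n \<Longrightarrow> polybounded X (\<lambda>x. Suc (f x)) n"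
  using polybounded_add[OF _ polybounded_const[of X 1]] by simp

lemma polybounded_power [polybounded_intros]: "polybounded X f n \<Longrightarrow> polybounded X (\<lambda>x. f x ^ k) n"
  by (induction k) (auto intro: polybounded_intros)

lemma polybounded_trans:
  assumes "polybounded X f g" "polybounded X g n"
  shows "polybounded X f n"
proof -
  obtain a b where "\<And>x. x \<in> X \<Longrightarrow> f x \<le> a * Suc (g x) ^ b"
    using assms(1) unfolding polybounded_def by blast
  moreover have "polybounded X (\<lambda>x. a * Suc (g x) ^ b) n"
    by (intro polybounded_intros assms(2))
  ultimately show ?thesis by (rule polybounded_mono[rotated])
qed

lemma polybounded_compose:
  "polybounded Y f n \<Longrightarrow> (\<And>x. x \<in> X \<Longrightarrow> h x \<in> Y) \<Longrightarrow> polybounded X (\<lambda>x. f (h x)) (\<lambda>x. n (h x))"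
  unfolding polybounded_def by blast

lemma polybounded_monomial:
  assumes "polybounded X f n"
  obtains a b where "\<And>x. x \<in> X \<Longrightarrow> f x \<le> a * n x ^ b + a"
proof -
  obtain a b where bound: "\<And>x. x \<in> X \<Longrightarrow> f x \<le> a * Suc (n x) ^ b"
    using assms unfolding polybounded_def by blast
  have "Suc m ^ b \<le> 2 ^ b * (m ^ b + 1)" for m :: nat
  proof (cases "m = 0")
    case False
    then have "Suc m ^ b \<le> (2 * m) ^ b" by (intro power_mono) auto
    then show ?thesis by (simp add: power_mult_distrib)
  qed (simp add: trans_le_add1)
  then have "a * Suc (n x) ^ b \<le> (a * 2 ^ b) * n x ^ b + a * 2 ^ b" for x
    using mult_le_mono2[of "Suc (n x) ^ b" "2 ^ b * (n x ^ b + 1)" a] by (simp add: algebra_simps)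
  then show thesis using bound le_trans that by blast
qed

definition polyrun ::
    "'a set \<Rightarrow> ('a \<Rightarrow> nat) \<Rightarrow> 'i prog \<Rightarrow> ('a \<Rightarrow> 'i store) \<Rightarrow> ('a \<Rightarrow> 'i store) \<Rightarrow> bool" where
  "polyrun X n c s s' \<longleftrightarrow> (\<exists>t. polybounded X t n \<and> (\<forall>x\<in>X. runs c (s x) (t x) (s' x)))"

lemma polyrunI:
  "polybounded X t n \<Longrightarrow> (\<And>x. x \<in> X \<Longrightarrow> runs c (s x) (t x) (s' x)) \<Longrightarrow> polyrun X n c s s'"
  unfolding polyrun_def by blast

lemma polyrunE:
  assumes "polyrun X n c s s'"
  obtains a b where "\<And>x. x \<in> X \<Longrightarrow> runs c (s x) (a * Suc (n x) ^ b) (s' x)"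
proof -
  obtain t a b where time: "\<And>x. x \<in> X \<Longrightarrow> t x \<le> a * Suc (n x) ^ b"
      "\<And>x. x \<in> X \<Longrightarrow> runs c (s x) (t x) (s' x)"
    using assms unfolding polyrun_def polybounded_def by blast
  show thesis by (rule that) (rule runs_mono[OF time(2) time(1)])
qed

lemma polyrun_cong:
  "polyrun X n c s s' \<Longrightarrow> (\<And>x. x \<in> X \<Longrightarrow> s x = r x) \<Longrightarrow> (\<And>x. x \<in> X \<Longrightarrow> s' x = r' x) \<Longrightarrow> polyrun X n c r r'"
  unfolding polyrun_def by auto

lemma polyrun_measure:
  assumes "polyrun X m c s s'" "polybounded X m n"
  shows "polyrun X n c s s'"
proof -
  obtain t where time: "polybounded X t m" "\<And>x. x \<in> X \<Longrightarrow> runs c (s x) (t x) (s' x)"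
    using assms(1) unfolding polyrun_def by blast
  show ?thesis by (rule polyrunI[OF polybounded_trans[OF time(1) assms(2)] time(2)])
qed

lemma polyrun_compose:
  assumes "polyrun Y n c s s'" "\<And>x. x \<in> X \<Longrightarrow> h x \<in> Y"
  shows "polyrun X (\<lambda>x. n (h x)) c (\<lambda>x. s (h x)) (\<lambda>x. s' (h x))"
proof -
  obtain t where time: "polybounded Y t n" "\<And>x. x \<in> Y \<Longrightarrow> runs c (s x) (t x) (s' x)"
    using assms(1) unfolding polyrun_def by blast
  show ?thesis by (rule polyrunI[OF polybounded_compose[OF time(1) assms(2)] time(2)[OF assms(2)]])
qed

lemma polybounded_length_polyrun:
  assumes "polyrun X n c s s'" "polybounded X (\<lambda>x. length (s x i)) n"
  shows "polybounded X (\<lambda>x. length (s' x i)) n"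
proof -
  obtain t where time: "polybounded X t n" "\<And>x. x \<in> X \<Longrightarrow> runs c (s x) (t x) (s' x)"
    using assms(1) unfolding polyrun_def by blast
  show ?thesis
    by (rule polybounded_mono[OF polybounded_add[OF assms(2) time(1)]])
      (rule length_runs[OF time(2)])
qed

lemma polyrun_Seq [trans]:
  assumes "polyrun X n c s s'" "polyrun X n d s' s''"
  shows "polyrun X n (c ;; d) s s''"
proof -
  obtain t u where time_c: "polybounded X t n" "\<And>x. x \<in> X \<Longrightarrow> runs c (s x) (t x) (s' x)"
    and time_d: "polybounded X u n" "\<And>x. x \<in> X \<Longrightarrow> runs d (s' x) (u x) (s'' x)"
    using assms unfolding polyrun_def by blast
  show ?thesis
  proof (rule polyrunI)
    show "polybounded X (\<lambda>x. t x + u x + 1) n"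
      by (intro polybounded_intros time_c time_d)
    show "runs (c ;; d) (s x) (t x + u x + 1) (s'' x)" if "x \<in> X" for x
      using time_c(2)[OF that] time_d(2)[OF that] by (rule runs_Seq)
  qed
qed

lemma polyrun_Cond:
  assumes "polyrun {x \<in> X. P (peek (s x i))} n c s s'"
    and "polyrun {x \<in> X. \<not> P (peek (s x i))} n d s s'"
  shows "polyrun X n (Cond i P c d) s s'"
proof -
  obtain a b where then_branch: "\<And>x. x \<in> {x \<in> X. P (peek (s x i))}
      \<Longrightarrow> runs c (s x) (a * Suc (n x) ^ b) (s' x)"
    using polyrunE[OF assms(1)] by blast
  obtain a' b' where else_branch: "\<And>x. x \<in> {x \<in> X. \<not> P (peek (s x i))}
      \<Longrightarrow> runs d (s x) (a' * Suc (n x) ^ b') (s' x)"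
    using polyrunE[OF assms(2)] by blast
  have branch: "runs (if P (peek (s x i)) then c else d) (s x)
      (a * Suc (n x) ^ b + a' * Suc (n x) ^ b') (s' x)"
    if "x \<in> X" for x
    using that runs_mono[OF then_branch[of x]] runs_mono[OF else_branch[of x]] by simp
  show ?thesis
  proof (rule polyrunI)
    show "polybounded X (\<lambda>x. a * Suc (n x) ^ b + a' * Suc (n x) ^ b' + 1) n"
      by (intro polybounded_intros)
    show "runs (Cond i P c d) (s x) (a * Suc (n x) ^ b + a' * Suc (n x) ^ b' + 1) (s' x)"
      if "x \<in> X" for x
      using branch[OF that] by (rule runs_Cond)
  qed
qed

lemma polyrun_While:
  assumes body: "polyrun {z. fst z \<in> X \<and> snd z < N (fst z)} (\<lambda>z. n (fst z)) c
      (\<lambda>z. S (fst z) (snd z)) (\<lambda>z. S (fst z) (Suc (snd z)))"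
    and N: "polybounded X N n"
    and continue: "\<And>x k. x \<in> X \<Longrightarrow> k < N x \<Longrightarrow> P (peek (S x k i))"
    and stop: "\<And>x. x \<in> X \<Longrightarrow> \<not> P (peek (S x (N x) i))"
  shows "polyrun X n (While i P c) (\<lambda>x. S x 0) (\<lambda>x. S x (N x))"
proof -
  obtain a b where "\<And>z. z \<in> {z. fst z \<in> X \<and> snd z < N (fst z)} \<Longrightarrow>
      runs c (S (fst z) (snd z)) (a * Suc (n (fst z)) ^ b) (S (fst z) (Suc (snd z)))"
    using polyrunE[OF body] by blast
  then have step: "runs c (S x k) (a * Suc (n x) ^ b) (S x (Suc k))" if "x \<in> X" "k < N x" for x k
    using that by force
  have loop: "runs (While i P c) (S x (N x - k)) (k * (a * Suc (n x) ^ b + 1) + 1) (S x (N x))"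
    if "x \<in> X" "k \<le> N x" for x k
    using that(2)
  proof (induction k)
    case 0
    show ?case using runs_While_False[of P "S x (N x)" i c] stop[OF that(1)] by simp
  next
    case (Suc k)
    let ?k = "N x - Suc k"
    have step_index: "?k < N x" "Suc ?k = N x - k" using Suc.prems by simp_all
    have "runs c (S x ?k) (a * Suc (n x) ^ b) (S x (N x - k))"
      using step[OF that(1) step_index(1)] step_index(2) by simp
    then have "runs (While i P c) (S x ?k)
        (a * Suc (n x) ^ b + (k * (a * Suc (n x) ^ b + 1) + 1) + 1) (S x (N x))"
      by (rule runs_While_True[of P "S x ?k" i, OF continue[OF that(1) step_index(1)]])
        (use Suc in simp)
    then show ?case by (rule runs_mono) simp
  qed
  show ?thesis
  proof (rule polyrunI)
    show "polybounded X (\<lambda>x. N x * (a * Suc (n x) ^ b + 1) + 1) n"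
      by (intro polybounded_intros N)
    show "runs (While i P c) (S x 0) (N x * (a * Suc (n x) ^ b + 1) + 1) (S x (N x))"
      if "x \<in> X" for x
      using loop[OF that, of "N x"] by simp
  qed
qed

subsection \<open>Loop-free programs\<close>

primrec loop_free :: "'i prog \<Rightarrow> bool" where
  "loop_free Skip \<longleftrightarrow> True"
| "loop_free (Push i b) \<longleftrightarrow> True"
| "loop_free (Pop i) \<longleftrightarrow> True"
| "loop_free (c ;; d) \<longleftrightarrow> loop_free c \<and> loop_free d"
| "loop_free (Cond i P c d) \<longleftrightarrow> loop_free c \<and> loop_free d"
| "loop_free (While i P c) \<longleftrightarrow> False"

primrec exec :: "'i prog \<Rightarrow> 'i store \<Rightarrow> 'i store" where
  "exec Skip s = s"
| "exec (Push i b) s = s(i := b # s i)"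
| "exec (Pop i) s = s(i := tl (s i))"
| "exec (c ;; d) s = exec d (exec c s)"
| "exec (Cond i P c d) s = (if P (peek (s i)) then exec c s else exec d s)"
| "exec (While i P c) s = undefined"

primrec cost :: "'i prog \<Rightarrow> nat" where
  "cost Skip = 1"
| "cost (Push i b) = 1"
| "cost (Pop i) = 1"
| "cost (c ;; d) = cost c + cost d + 1"
| "cost (Cond i P c d) = cost c + cost d + 1"
| "cost (While i P c) = undefined"

lemma runs_exec: "loop_free c \<Longrightarrow> runs c s (cost c) (exec c s)"
proof (induction c arbitrary: s)
  case (Seq c d)
  then show ?case using runs_Seq[of c s "cost c" "exec c s" d "cost d"] by simp
next
  case (Cond i P c d)
  then have "runs (if P (peek (s i)) then c else d) s (cost c + cost d) (exec (Cond i P c d) s)"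
    using runs_mono[of c s "cost c"] runs_mono[of d s "cost d"] by simp
  then show ?case unfolding cost.simps by (rule runs_Cond)
qed (auto intro: runs.intros)

lemma polyrun_exec:
  assumes "loop_free c" "\<And>x. x \<in> X \<Longrightarrow> exec c (s x) = s' x"
  shows "polyrun X n c s s'"
  by (rule polyrunI[OF polybounded_const[of X "cost c"]]) (metis assms runs_exec)

section \<open>Polynomial-time functions on structured data\<close>

subsection \<open>Trees on the main stack\<close>

datatype tree = Tip | Branch tree tree

primrec code :: "tree \<Rightarrow> bool list" where
  "code Tip = [False]"
| "code (Branch l r) = True # code l @ code r"

lemma code_append_inject: "code t @ xs = code u @ ys \<longleftrightarrow> t = u \<and> xs = ys"
proof (induction t arbitrary: u xs ys)
  case Tip
  show ?case by (cases u) auto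
next
  case (Branch l r)
  then show ?case by (cases u) auto
qed

text \<open>\<open>Aux1\<close> also holds the input and the output; the height of \<open>Pending\<close> is the number of subtrees
  still to be read.\<close>

datatype stack = Main | Aux1 | Aux2 | Pending

instance stack :: finite
proof
  have "UNIV \<subseteq> {Main, Aux1, Aux2, Pending}" using stack.exhaust by blast
  then show "finite (UNIV :: stack set)" using finite_subset by blast
qed

definition state :: "bool list \<Rightarrow> bool list \<Rightarrow> bool list \<Rightarrow> bool list \<Rightarrow> stack store" where
  "state m a b p = (\<lambda>i. case i of Main \<Rightarrow> m | Aux1 \<Rightarrow> a | Aux2 \<Rightarrow> b | Pending \<Rightarrow> p)"

lemma state_simps [simp]:
  "state m a b p Main = m" "state m a b p Aux1 = a"
  "state m a b p Aux2 = b" "state m a b p Pending = p"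
  "(state m a b p)(Main := x) = state x a b p" "(state m a b p)(Aux1 := x) = state m x b p"
  "(state m a b p)(Aux2 := x) = state m a x p" "(state m a b p)(Pending := x) = state m a b x"
  by (auto simp: state_def fun_eq_iff split: stack.splits)

abbreviation main :: "bool list \<Rightarrow> stack store" where
  "main m \<equiv> state m [] [] []"

primrec push_list :: "bool list \<Rightarrow> stack prog" where
  "push_list [] = Skip"
| "push_list (b # bs) = push_list bs ;; Push Main b"

lemma loop_free_push_list [simp]: "loop_free (push_list bs)"
  by (induction bs) auto

lemma exec_push_list [simp]: "exec (push_list bs) (state m a b p) = state (bs @ m) a b p"
  by (induction bs) auto

definition clear :: "stack \<Rightarrow> stack prog" where
  "clear i = While i (\<lambda>x. x \<noteq> None) (Pop i)"

definition move_bit :: "stack \<Rightarrow> stack prog" where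
  "move_bit i = Cond i (\<lambda>x. x = Some True) (Pop i ;; Push Main True) (Pop i ;; Push Main False)"

definition flush :: "stack \<Rightarrow> stack prog" where
  "flush i = While i (\<lambda>x. x \<noteq> None) (move_bit i)"

lemma polyrun_clear:
  assumes "polybounded X (\<lambda>x. length (s x i)) n"
  shows "polyrun X n (clear i) s (\<lambda>x. (s x)(i := []))"
proof -
  have "polyrun X n (clear i) (\<lambda>x. (s x)(i := drop 0 (s x i)))
      (\<lambda>x. (s x)(i := drop (length (s x i)) (s x i)))"
    unfolding clear_def
    by (rule polyrun_While[OF polyrun_exec assms])
      (auto simp: drop_Suc tl_drop Cons_nth_drop_Suc[symmetric])
  then show ?thesis by simp
qed

lemma polyrun_flush:
  assumes "i \<noteq> Main" "polybounded X (\<lambda>x. length (s x i)) n"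
  shows "polyrun X n (flush i) s (\<lambda>x. (s x)(i := [], Main := rev (s x i) @ s x Main))"
proof -
  define S where "S x k = (s x)(i := drop k (s x i), Main := rev (take k (s x i)) @ s x Main)"
      for x k
  have "polyrun X n (flush i) (\<lambda>x. S x 0) (\<lambda>x. S x (length (s x i)))"
    unfolding flush_def
  proof (rule polyrun_While[OF polyrun_exec assms(2)])
    fix z assume "z \<in> {z. fst z \<in> X \<and> snd z < length (s (fst z) i)}"
    then obtain x k where z_eq: "z = (x, k)" "k < length (s x i)" by (cases z) auto
    have "drop k (s x i) = s x i ! k # drop (Suc k) (s x i)"
      "take (Suc k) (s x i) = take k (s x i) @ [s x i ! k]"
      using z_eq(2) by (simp_all add: Cons_nth_drop_Suc take_Suc_conv_app_nth)
    then show "exec (move_bit i) (S (fst z) (snd z)) = S (fst z) (Suc (snd z))"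
      using assms(1) by (auto simp: move_bit_def z_eq S_def fun_eq_iff)
  qed (use assms(1) in \<open>auto simp: move_bit_def S_def Cons_nth_drop_Suc[symmetric]\<close>)
  then show ?thesis
    by (rule polyrun_cong) (auto simp: S_def fun_eq_iff)
qed

definition put :: "'i list \<Rightarrow> bool list \<Rightarrow> 'i store \<Rightarrow> 'i store" where
  "put js u s = (\<lambda>j. if j \<in> set js then u @ s j else s j)"

primrec push_all :: "'i list \<Rightarrow> bool \<Rightarrow> 'i prog" where
  "push_all [] b = Skip"
| "push_all (j # js) b = Push j b ;; push_all js b"

lemma loop_free_push_all [simp]: "loop_free (push_all js b)"
  by (induction js) auto

lemma exec_push_all [simp]: "distinct js \<Longrightarrow> exec (push_all js b) s = put js [b] s"
  by (induction js arbitrary: s) (auto simp: put_def)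

lemma put_simps [simp]:
  "put [] u s = s" "j \<notin> set js \<Longrightarrow> put (j # js) u s = (put js u s)(j := u @ s j)"
  by (auto simp: put_def)

lemma put_upd: "i \<notin> set js \<Longrightarrow> put js u (s(i := x)) = (put js u s)(i := x)"
  by (auto simp: put_def)

lemma put_other: "i \<notin> set js \<Longrightarrow> put js u s i = s i"
  by (auto simp: put_def)

definition grab_body :: "stack list \<Rightarrow> stack prog" where
  "grab_body js = Cond Main (\<lambda>x. x = Some True)
     (Pop Main ;; push_all js True ;; Push Pending True)
     (Pop Main ;; push_all js False ;; Pop Pending)"

definition grab_loop :: "stack list \<Rightarrow> stack prog" where
  "grab_loop js = While Pending (\<lambda>x. x \<noteq> None) (grab_body js)"

definition grab :: "stack list \<Rightarrow> stack prog" where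
  "grab js = Push Pending True ;; grab_loop js"

lemma loop_free_grab_body: "loop_free (grab_body js)"
  by (simp add: grab_body_def)

lemma runs_grab_loop_step:
  assumes "s Pending \<noteq> []" "runs (grab_loop js) (exec (grab_body js) s) T s'"
  shows "runs (grab_loop js) s (cost (grab_body js) + T + 1) s'"
  using assms(2) unfolding grab_loop_def
  by (rule runs_While_True[OF _ runs_exec[OF loop_free_grab_body], rotated])
    (use assms(1) in \<open>cases "s Pending"; simp\<close>)

lemma runs_grab_loop:
  assumes js: "distinct js" "Main \<notin> set js" "Pending \<notin> set js"
    and "s Main = code t @ r" "s Pending = y # p"
    and "runs (grab_loop js) (put js (rev (code t)) (s(Main := r, Pending := p))) T s'"
  shows "runs (grab_loop js) s (T + Suc (cost (grab_body js)) * length (code t)) s'"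
  using assms(4-6)
proof (induction t arbitrary: s r y p T)
  case Tip
  have "exec (grab_body js) s = put js [False] (s(Main := r, Pending := p))"
    using js Tip by (simp add: grab_body_def put_upd put_other)
  then have "runs (grab_loop js) s (cost (grab_body js) + T + 1) s'"
    using Tip.prems by (intro runs_grab_loop_step) (simp_all del: fun_upd_apply)
  then show ?case by (simp add: add.commute)
next
  case (Branch l u)
  let ?s = "put js [True] (s(Main := code l @ code u @ r, Pending := True # y # p))"
    and ?K = "Suc (cost (grab_body js))"
  have "exec (grab_body js) s = ?s"
    using js Branch.prems by (simp add: grab_body_def put_upd put_other)
  moreover have "runs (grab_loop js) ?s (T + ?K * length (code u) + ?K * length (code l)) s'"
  proof (rule Branch.IH(1))
    show "runs (grab_loop js) (put js (rev (code l)) (?s(Main := code u @ r, Pending := y # p)))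
        (T + ?K * length (code u)) s'"
    proof (rule Branch.IH(2))
      have "put js (rev (code u))
            ((put js (rev (code l)) (?s(Main := code u @ r, Pending := y # p)))
              (Main := r, Pending := p))
          = put js (rev (code (Branch l u))) (s(Main := r, Pending := p))"
        using js by (auto simp: put_def fun_eq_iff)
      with Branch.prems(3) show "runs (grab_loop js) (put js (rev (code u))
          ((put js (rev (code l)) (?s(Main := code u @ r, Pending := y # p)))
            (Main := r, Pending := p))) T s'"
        by (simp only:)
    qed (use js in \<open>simp_all add: put_other\<close>)
  qed (use js in \<open>simp_all add: put_other\<close>)
  ultimately have "runs (grab_loop js) s
      (cost (grab_body js) + (T + ?K * length (code u) + ?K * length (code l)) + 1) s'"
    using Branch.prems(2) by (intro runs_grab_loop_step) simp_all
  then show ?case by (rule runs_mono) (simp add: algebra_simps)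
qed

lemma polyrun_grab:
  assumes js: "distinct js" "Main \<notin> set js" "Pending \<notin> set js"
    and stacks: "\<And>x. x \<in> X \<Longrightarrow> s x Main = code (t x) @ r x" "\<And>x. x \<in> X \<Longrightarrow> s x Pending = []"
    and "polybounded X (\<lambda>x. length (code (t x))) n"
  shows "polyrun X n (grab js) s (\<lambda>x. put js (rev (code (t x))) ((s x)(Main := r x)))"
proof -
  have "polyrun X n (Push Pending True) s (\<lambda>x. (s x)(Pending := [True]))"
    by (rule polyrun_exec) (simp_all add: stacks)
  also have "polyrun X n (grab_loop js) \<dots> (\<lambda>x. put js (rev (code (t x))) ((s x)(Main := r x)))"
  proof (rule polyrunI)
    let ?s' = "\<lambda>x. put js (rev (code (t x))) ((s x)(Main := r x))"
    show "polybounded X (\<lambda>x. 1 + Suc (cost (grab_body js)) * length (code (t x))) n"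
      by (intro polybounded_intros assms)
    show "runs (grab_loop js) ((s x)(Pending := [True]))
        (1 + Suc (cost (grab_body js)) * length (code (t x))) (?s' x)"
      if "x \<in> X" for x
    proof (rule runs_grab_loop[OF js])
      have "(s x)(Pending := []) = s x" using stacks(2)[OF that] by (metis fun_upd_triv)
      then show "runs (grab_loop js) (put js (rev (code (t x)))
          ((s x)(Pending := [True], Main := r x, Pending := []))) 1 (?s' x)"
        using runs_While_False[of "\<lambda>x. x \<noteq> None" "?s' x" Pending "grab_body js"] js
          stacks(2)[OF that]
        by (simp add: grab_loop_def put_other fun_upd_twist)
    qed (use stacks that in auto)
  qed
  finally show ?thesis unfolding grab_def .
qed

subsection \<open>Data types coded as trees\<close>

class data =
  fixes to_tree :: "'a \<Rightarrow> tree"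
  assumes inj_to_tree: "inj to_tree"

lemma to_tree_inject [simp]: "to_tree x = to_tree y \<longleftrightarrow> x = y"
  using inj_to_tree by (rule inj_eq)

instantiation bool :: data
begin
definition to_tree_bool :: "bool \<Rightarrow> tree" where
  "to_tree_bool b = (if b then Branch Tip Tip else Tip)"
instance by standard (auto simp: inj_def to_tree_bool_def)
end

instantiation prod :: (data, data) data
begin
definition to_tree_prod :: "'a \<times> 'b \<Rightarrow> tree" where
  "to_tree_prod x = Branch (to_tree (fst x)) (to_tree (snd x))"
instance by standard (simp add: inj_def to_tree_prod_def)
end

instantiation list :: (data) data
begin
primrec to_tree_list :: "'a list \<Rightarrow> tree" where
  "to_tree_list [] = Tip"
| "to_tree_list (x # xs) = Branch (to_tree x) (to_tree_list xs)"
instance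
proof
  have "to_tree xs = to_tree ys \<Longrightarrow> xs = ys" for xs ys :: "'a list"
  proof (induction xs arbitrary: ys)
    case Nil
    then show ?case by (cases ys) auto
  next
    case (Cons x xs)
    then show ?case by (cases ys) auto
  qed
  then show "inj (to_tree :: 'a list \<Rightarrow> tree)" by (rule injI)
qed
end

definition bits :: "'a::data \<Rightarrow> bool list" where
  "bits x = code (to_tree x)"

definition bitsize :: "'a::data \<Rightarrow> nat" where
  "bitsize x = length (bits x)"

lemma bits_simps [simp]:
  "bits True = [True, False, False]" "bits False = [False]"
  "bits (x, y) = True # bits x @ bits y"
  "bits [] = [False]" "bits (x # xs) = True # bits x @ bits xs"
  by (simp_all add: bits_def to_tree_bool_def to_tree_prod_def)

lemma bits_inject: "bits x = bits y \<longleftrightarrow> x = y"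
  using code_append_inject[of "to_tree x" "[]" "to_tree y" "[]"] by (simp add: bits_def)

lemma bitsize_simps [simp]:
  "bitsize True = 3" "bitsize False = 1" "bitsize (x, y) = Suc (bitsize x + bitsize y)"
  "bitsize [] = 1" "bitsize (x # xs) = Suc (bitsize x + bitsize xs)"
  by (simp_all add: bitsize_def)

lemma polyrun_grab_bits:
  assumes "distinct js" "Main \<notin> set js" "Pending \<notin> set js" "polybounded X (\<lambda>z. bitsize (x z)) n"
    "\<And>z. z \<in> X \<Longrightarrow> s z Main = bits (x z) @ r z" "\<And>z. z \<in> X \<Longrightarrow> s z Pending = []"
  shows "polyrun X n (grab js) s (\<lambda>z. put js (rev (bits (x z))) ((s z)(Main := r z)))"
  using assms unfolding bits_def bitsize_def by (intro polyrun_grab)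

abbreviation drop_arg :: "stack prog" where
  "drop_arg \<equiv> grab []"

definition dup_arg :: "stack prog" where
  "dup_arg = grab [Aux1, Aux2] ;; flush Aux1 ;; flush Aux2"

definition swap_args :: "stack prog" where
  "swap_args = grab [Aux1] ;; grab [Aux2] ;; flush Aux1 ;; flush Aux2"

context
  fixes X :: "'z set" and n :: "'z \<Rightarrow> nat" and x :: "'z \<Rightarrow> 'a::data" and r :: "'z \<Rightarrow> bool list"
  assumes size_x: "polybounded X (\<lambda>z. bitsize (x z)) n"
begin

lemma polyrun_drop_arg: "polyrun X n drop_arg (\<lambda>z. main (bits (x z) @ r z)) (\<lambda>z. main (r z))"
  by (rule polyrun_cong[OF polyrun_grab_bits[OF _ _ _ size_x]]) auto

lemma polyrun_dup_arg:
  "polyrun X n dup_arg (\<lambda>z. main (bits (x z) @ r z)) (\<lambda>z. main (bits (x z) @ bits (x z) @ r z))"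
proof -
  have "polyrun X n (grab [Aux1, Aux2]) (\<lambda>z. main (bits (x z) @ r z))
      (\<lambda>z. state (r z) (rev (bits (x z))) (rev (bits (x z))) [])"
    by (rule polyrun_cong[OF polyrun_grab_bits[OF _ _ _ size_x]]) auto
  also have "polyrun X n (flush Aux1) \<dots> (\<lambda>z. state (bits (x z) @ r z) [] (rev (bits (x z))) [])"
    by (rule polyrun_cong[OF polyrun_flush]) (use size_x in \<open>auto simp: bitsize_def\<close>)
  also have "polyrun X n (flush Aux2) \<dots> (\<lambda>z. main (bits (x z) @ bits (x z) @ r z))"
    by (rule polyrun_cong[OF polyrun_flush]) (use size_x in \<open>auto simp: bitsize_def\<close>)
  finally show ?thesis by (simp only: dup_arg_def)
qed

lemma polyrun_swap_args:
  fixes y :: "'z \<Rightarrow> 'b::data"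
  assumes "polybounded X (\<lambda>z. bitsize (y z)) n"
  shows "polyrun X n swap_args (\<lambda>z. main (bits (x z) @ bits (y z) @ r z))
      (\<lambda>z. main (bits (y z) @ bits (x z) @ r z))"
proof -
  have "polyrun X n (grab [Aux1]) (\<lambda>z. main (bits (x z) @ bits (y z) @ r z))
      (\<lambda>z. state (bits (y z) @ r z) (rev (bits (x z))) [] [])"
    by (rule polyrun_cong[OF polyrun_grab_bits[OF _ _ _ size_x]]) auto
  also have "polyrun X n (grab [Aux2]) \<dots> (\<lambda>z. state (r z) (rev (bits (x z))) (rev (bits (y z))) [])"
    by (rule polyrun_cong[OF polyrun_grab_bits[OF _ _ _ assms]]) auto
  also have "polyrun X n (flush Aux1) \<dots> (\<lambda>z. state (bits (x z) @ r z) [] (rev (bits (y z))) [])"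
    by (rule polyrun_cong[OF polyrun_flush]) (use size_x in \<open>auto simp: bitsize_def\<close>)
  also have "polyrun X n (flush Aux2) \<dots> (\<lambda>z. main (bits (y z) @ bits (x z) @ r z))"
    by (rule polyrun_cong[OF polyrun_flush]) (use assms in \<open>auto simp: bitsize_def\<close>)
  finally show ?thesis by (simp only: swap_args_def)
qed

end

subsection \<open>Closure properties\<close>

definition implements :: "stack prog \<Rightarrow> ('a::data \<Rightarrow> 'b::data) \<Rightarrow> bool" where
  "implements c f \<longleftrightarrow> polyrun UNIV (\<lambda>z. bitsize (fst z)) c (\<lambda>z. main (bits (fst z) @ snd z))
    (\<lambda>z. main (bits (f (fst z)) @ snd z))"

definition polytime :: "('a::data \<Rightarrow> 'b::data) \<Rightarrow> bool" where
  "polytime f \<longleftrightarrow> (\<exists>c. implements c f)"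

named_theorems polytime_intros

lemma polyrun_implements:
  assumes "implements c f" "polybounded X (\<lambda>z. bitsize (x z)) n"
  shows "polyrun X n c (\<lambda>z. main (bits (x z) @ r z)) (\<lambda>z. main (bits (f (x z)) @ r z))"
proof -
  have "polyrun X (\<lambda>z. bitsize (x z)) c (\<lambda>z. main (bits (x z) @ r z))
      (\<lambda>z. main (bits (f (x z)) @ r z))"
    using polyrun_compose[OF assms(1)[unfolded implements_def], of X "\<lambda>z. (x z, r z)"] by simp
  then show ?thesis using assms(2) by (rule polyrun_measure)
qed

lemma polytimeI:
  assumes "polyrun UNIV (\<lambda>z. bitsize (fst z)) c (\<lambda>z. main (bits (fst z) @ snd z))
      (\<lambda>z. main (bits (f (fst z)) @ snd z))"
  shows "polytime f"
  using assms unfolding polytime_def implements_def by blast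

lemma polybounded_bitsize:
  assumes "polytime f" "polybounded X (\<lambda>z. bitsize (x z)) n"
  shows "polybounded X (\<lambda>z. bitsize (f (x z))) n"
proof -
  obtain c where impl: "implements c f" using assms(1) by (auto simp: polytime_def)
  show ?thesis
    using polybounded_length_polyrun[OF polyrun_implements[OF impl assms(2), of "\<lambda>_. []"], of Main]
      assms(2)
    by (simp add: bitsize_def)
qed

lemma polytime_cong_bits:
  assumes "polytime f" "\<And>x. bits (g x) = bits (f x)"
  shows "polytime g"
  using assms by (simp add: polytime_def implements_def)

lemma polytime_id [polytime_intros]: "polytime (\<lambda>x. x)"
  by (rule polytimeI[OF polyrun_exec[of Skip]]) auto

lemma polytime_comp:
  assumes "polytime g" "polytime f"
  shows "polytime (\<lambda>x. g (f x))"
proof -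
  obtain c d where impl_g: "implements c g" and impl_f: "implements d f"
    using assms by (auto simp: polytime_def)
  let ?n = "\<lambda>z. bitsize (fst z)"
  have "polyrun UNIV ?n d (\<lambda>z. main (bits (fst z) @ snd z)) (\<lambda>z. main (bits (f (fst z)) @ snd z))"
    by (intro polyrun_implements impl_f polybounded_self)
  also have "polyrun UNIV ?n c \<dots> (\<lambda>z. main (bits (g (f (fst z))) @ snd z))"
    by (intro polyrun_implements impl_g polybounded_bitsize[OF assms(2)] polybounded_self)
  finally show ?thesis by (rule polytimeI)
qed

lemma polytime_const [polytime_intros]: "polytime (\<lambda>_. k)"
proof (rule polytimeI)
  have "polyrun UNIV (\<lambda>z. bitsize (fst z)) drop_arg (\<lambda>z. main (bits (fst z) @ snd z))
      (\<lambda>z. main (snd z))"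
    by (intro polyrun_drop_arg polybounded_self)
  also have "polyrun UNIV (\<lambda>z. bitsize (fst z)) (push_list (bits k)) \<dots> (\<lambda>z. main (bits k @ snd z))"
    by (rule polyrun_exec) simp_all
  finally show "polyrun UNIV (\<lambda>z. bitsize (fst z)) (drop_arg ;; push_list (bits k))
      (\<lambda>z. main (bits (fst z) @ snd z)) (\<lambda>z. main (bits k @ snd z))" .
qed

lemma polyrun_open_pair:
  "polyrun X n (Pop Main) (\<lambda>z. main (bits (x z) @ r z))
    (\<lambda>z. main (bits (fst (x z)) @ bits (snd (x z)) @ r z))"
proof (rule polyrun_exec)
  show "exec (Pop Main) (main (bits (x z) @ r z))
      = main (bits (fst (x z)) @ bits (snd (x z)) @ r z)" for z
    by (cases "x z") simp
qed simp

lemma polybounded_bitsize_pair: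
  "polybounded X (\<lambda>z. bitsize (fst (x z))) (\<lambda>z. bitsize (x z))"
  "polybounded X (\<lambda>z. bitsize (snd (x z))) (\<lambda>z. bitsize (x z))"
proof -
  have components: "bitsize (x z) = Suc (bitsize (fst (x z)) + bitsize (snd (x z)))" for z
    by (cases "x z") simp
  show "polybounded X (\<lambda>z. bitsize (fst (x z))) (\<lambda>z. bitsize (x z))"
    "polybounded X (\<lambda>z. bitsize (snd (x z))) (\<lambda>z. bitsize (x z))"
    by (rule polybounded_mono[OF polybounded_self]; simp add: components)+
qed

lemma polytime_fst [polytime_intros]:
  fixes f :: "'a::data \<Rightarrow> 'b::data \<times> 'c::data"
  assumes "polytime f"
  shows "polytime (\<lambda>x. fst (f x))"
proof -
  let ?n = "\<lambda>z. bitsize (fst z :: 'b \<times> 'c)"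
  note polyrun_open_pair
  also have "polyrun UNIV ?n swap_args (\<lambda>z. main (bits (fst (fst z)) @ bits (snd (fst z)) @ snd z))
      (\<lambda>z. main (bits (snd (fst z)) @ bits (fst (fst z)) @ snd z))"
    by (intro polyrun_swap_args polybounded_bitsize_pair)
  also have "polyrun UNIV ?n drop_arg \<dots> (\<lambda>z. main (bits (fst (fst z)) @ snd z))"
    by (intro polyrun_drop_arg polybounded_bitsize_pair)
  finally have "polytime (fst :: 'b \<times> 'c \<Rightarrow> 'b)" by (rule polytimeI)
  then show ?thesis using assms by (rule polytime_comp)
qed

lemma polytime_snd [polytime_intros]:
  fixes f :: "'a::data \<Rightarrow> 'b::data \<times> 'c::data"
  assumes "polytime f"
  shows "polytime (\<lambda>x. snd (f x))"
proof -
  let ?n = "\<lambda>z. bitsize (fst z :: 'b \<times> 'c)"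
  note polyrun_open_pair
  also have "polyrun UNIV ?n drop_arg
      (\<lambda>z. main (bits (fst (fst z)) @ bits (snd (fst z)) @ snd z))
        (\<lambda>z. main (bits (snd (fst z)) @ snd z))"
    by (intro polyrun_drop_arg polybounded_bitsize_pair)
  finally have "polytime (snd :: 'b \<times> 'c \<Rightarrow> 'c)" by (rule polytimeI)
  then show ?thesis using assms by (rule polytime_comp)
qed

lemma polytime_Pair [polytime_intros]:
  assumes "polytime f" "polytime g"
  shows "polytime (\<lambda>x. (f x, g x))"
proof -
  obtain c d where impl_f: "implements c f" and impl_g: "implements d g"
    using assms by (auto simp: polytime_def)
  let ?n = "\<lambda>z. bitsize (fst z)"
  note size = polybounded_self polybounded_bitsize[OF assms(2) polybounded_self]
  have "polyrun UNIV ?n dup_arg (\<lambda>z. main (bits (fst z) @ snd z))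
      (\<lambda>z. main (bits (fst z) @ bits (fst z) @ snd z))"
    by (intro polyrun_dup_arg size)
  also have "polyrun UNIV ?n d \<dots> (\<lambda>z. main (bits (g (fst z)) @ bits (fst z) @ snd z))"
    by (intro polyrun_implements impl_g size)
  also have "polyrun UNIV ?n swap_args \<dots> (\<lambda>z. main (bits (fst z) @ bits (g (fst z)) @ snd z))"
    by (intro polyrun_swap_args size)
  also have "polyrun UNIV ?n c \<dots> (\<lambda>z. main (bits (f (fst z)) @ bits (g (fst z)) @ snd z))"
    by (intro polyrun_implements impl_f size)
  also have "polyrun UNIV ?n (Push Main True) \<dots> (\<lambda>z. main (bits (f (fst z), g (fst z)) @ snd z))"
    by (rule polyrun_exec) simp_all
  finally show ?thesis by (rule polytimeI)
qed

lemma polytime_uncurry: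
  assumes "polytime (\<lambda>(x, y). h x y)" "polytime f" "polytime g"
  shows "polytime (\<lambda>x. h (f x) (g x))"
  using polytime_comp[OF assms(1) polytime_Pair[OF assms(2,3)]] by simp

lemma polytime_case_prod [polytime_intros]:
  "polytime (\<lambda>x. h x (fst (f x)) (snd (f x))) \<Longrightarrow> polytime (\<lambda>x. case f x of (y, z) \<Rightarrow> h x y z)"
  by (simp add: case_prod_beta)

lemma polytime_Let [polytime_intros]:
  "polytime (\<lambda>x. h x (f x)) \<Longrightarrow> polytime (\<lambda>x. let y = f x in h x y)"
  by simp

text \<open>A nonempty list has the code of the pair of its head and its tail.\<close>

lemma polytime_Cons [polytime_intros]: "polytime f \<Longrightarrow> polytime g \<Longrightarrow> polytime (\<lambda>x. f x # g x)"
  by (rule polytime_cong_bits[OF polytime_Pair]) simp_all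

lemma polytime_If [polytime_intros]:
  assumes "polytime b" "polytime f" "polytime g"
  shows "polytime (\<lambda>x. if b x then f x else g x)"
proof -
  obtain a c d where impl: "implements a b" "implements c f" "implements d g"
    using assms by (auto simp: polytime_def)
  let ?n = "\<lambda>z. bitsize (fst z)"
    and ?arg = "\<lambda>z. main (bits (fst z) @ snd z)"
    and ?test = "\<lambda>z. main (bits (b (fst z)) @ bits (fst z) @ snd z)"
    and ?result = "\<lambda>z. main (bits (if b (fst z) then f (fst z) else g (fst z)) @ snd z)"
  note size = polybounded_self polybounded_bitsize[OF assms(1) polybounded_self]
  have "polyrun UNIV ?n dup_arg ?arg (\<lambda>z. main (bits (fst z) @ bits (fst z) @ snd z))"
    by (intro polyrun_dup_arg size)
  also have "polyrun UNIV ?n a \<dots> ?test"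
    by (intro polyrun_implements impl size)
  also have "polyrun UNIV ?n (Cond Main (\<lambda>x. x = Some True) (drop_arg ;; c) (drop_arg ;; d)) \<dots>
      ?result"
  proof (rule polyrun_Cond[OF polyrun_Seq polyrun_Seq])
    show drop: "polyrun X ?n drop_arg ?test ?arg" for X
      by (intro polyrun_drop_arg size)
    show "polyrun X ?n drop_arg ?test ?arg" for X
      by (rule drop)
    show "polyrun {z \<in> UNIV. peek (?test z Main) = Some True} ?n c ?arg ?result"
      by (rule polyrun_cong[OF polyrun_implements[OF impl(2) polybounded_self]])
        (auto split: if_splits)
    show "polyrun {z \<in> UNIV. peek (?test z Main) \<noteq> Some True} ?n d ?arg ?result"
      by (rule polyrun_cong[OF polyrun_implements[OF impl(3) polybounded_self]])
        (auto split: if_splits)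
  qed
  finally show ?thesis by (rule polytimeI)
qed

lemma polyrun_Cons_branch:
  assumes impl: "implements d (\<lambda>(x, y, ys). h x y ys)"
    and size: "polybounded X (\<lambda>z. bitsize (x z)) n" "polybounded X (\<lambda>z. bitsize (y z # ys z)) n"
  shows "polyrun X n (swap_args ;; Push Main True ;; d)
    (\<lambda>z. main (bits (y z # ys z) @ bits (x z) @ r z))
      (\<lambda>z. main (bits (h (x z) (y z) (ys z)) @ r z))"
proof -
  have "polyrun X n swap_args (\<lambda>z. main (bits (y z # ys z) @ bits (x z) @ r z))
      (\<lambda>z. main (bits (x z) @ bits (y z # ys z) @ r z))"
    by (intro polyrun_swap_args size)
  also have "polyrun X n (Push Main True) \<dots> (\<lambda>z. main (bits (x z, y z, ys z) @ r z))"
    by (rule polyrun_exec) simp_all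
  also have "polyrun X n d \<dots> (\<lambda>z. main (bits (h (x z) (y z) (ys z)) @ r z))"
  proof -
    have "polybounded X (\<lambda>z. Suc (bitsize (x z) + bitsize (y z # ys z))) n"
      by (intro polybounded_intros size)
    then have "polybounded X (\<lambda>z. bitsize (x z, y z, ys z)) n" by simp
    from polyrun_implements[OF impl this] show ?thesis by simp
  qed
  finally show ?thesis .
qed

lemma polytime_case_list [polytime_intros]:
  assumes "polytime f" "polytime g" "polytime (\<lambda>(x, y, ys). h x y ys)"
  shows "polytime (\<lambda>x. case f x of [] \<Rightarrow> g x | y # ys \<Rightarrow> h x y ys)"
proof -
  obtain a c d where impl: "implements a f" "implements c g" "implements d (\<lambda>(x, y, ys). h x y ys)"
    using assms by (auto simp: polytime_def)
  let ?n = "\<lambda>z. bitsize (fst z)"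
    and ?arg = "\<lambda>z. main (bits (fst z) @ snd z)"
    and ?list = "\<lambda>z. main (bits (f (fst z)) @ bits (fst z) @ snd z)"
    and ?result = "\<lambda>z. main (bits (case f (fst z) of [] \<Rightarrow> g (fst z) | y # ys \<Rightarrow> h (fst z) y ys)
        @ snd z)"
  note size = polybounded_self polybounded_bitsize[OF assms(1) polybounded_self]
  have is_Cons: "peek (?list z Main) = Some True \<longleftrightarrow> f (fst z) \<noteq> []" for z
    by (cases "f (fst z)") auto
  have "polyrun UNIV ?n dup_arg ?arg (\<lambda>z. main (bits (fst z) @ bits (fst z) @ snd z))"
    by (intro polyrun_dup_arg size)
  also have "polyrun UNIV ?n a \<dots> ?list"
    by (intro polyrun_implements impl size)
  also have "polyrun UNIV ?n
      (Cond Main (\<lambda>x. x = Some True) (swap_args ;; Push Main True ;; d) (drop_arg ;; c)) \<dots> ?result"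
  proof (rule polyrun_Cond; unfold is_Cons not_not)
    let ?Nil = "{z \<in> UNIV. f (fst z) = []}" and ?Cons = "{z \<in> UNIV. f (fst z) \<noteq> []}"
    have "polyrun ?Nil ?n drop_arg ?list ?arg"
      by (intro polyrun_drop_arg size)
    also have "polyrun ?Nil ?n c \<dots> ?result"
      by (rule polyrun_cong[OF polyrun_implements[OF impl(2) polybounded_self]]) auto
    finally show "polyrun ?Nil ?n (drop_arg ;; c) ?list ?result" .
    have "polybounded ?Cons (\<lambda>z. bitsize (hd (f (fst z)) # tl (f (fst z)))) ?n"
      by (rule polybounded_mono[OF size(2)]) (auto simp del: bitsize_simps)
    from polyrun_Cons_branch[OF impl(3) polybounded_self this, of snd]
    show "polyrun ?Cons ?n (swap_args ;; Push Main True ;; d) ?list ?result"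
      by (rule polyrun_cong) (auto simp: neq_Nil_conv)
  qed
  finally show ?thesis by (rule polytimeI)
qed

lemma polyrun_while_body:
  assumes impl: "implements a b" "implements c g" and "polytime b"
    and size: "polybounded X (\<lambda>z. bitsize (x z)) n" "polybounded X (\<lambda>z. bitsize (g (x z))) n"
  shows "polyrun X n (drop_arg ;; c ;; dup_arg ;; a)
    (\<lambda>z. main (bits (b (x z)) @ bits (x z) @ r z))
      (\<lambda>z. main (bits (b (g (x z))) @ bits (g (x z)) @ r z))"
proof -
  have "polyrun X n drop_arg (\<lambda>z. main (bits (b (x z)) @ bits (x z) @ r z))
      (\<lambda>z. main (bits (x z) @ r z))"
    by (intro polyrun_drop_arg polybounded_bitsize[OF assms(3)] size)
  also have "polyrun X n c \<dots> (\<lambda>z. main (bits (g (x z)) @ r z))"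
    by (intro polyrun_implements impl size)
  also have "polyrun X n dup_arg \<dots> (\<lambda>z. main (bits (g (x z)) @ bits (g (x z)) @ r z))"
    by (intro polyrun_dup_arg size)
  also have "polyrun X n a \<dots> (\<lambda>z. main (bits (b (g (x z))) @ bits (g (x z)) @ r z))"
    by (intro polyrun_implements impl size)
  finally show ?thesis .
qed

lemma polytime_while:
  fixes g :: "'a::data \<Rightarrow> 'a" and f :: "'b::data \<Rightarrow> 'a"
  assumes "polytime b" "polytime g" "polytime f"
    and N: "polybounded UNIV N bitsize"
    and size: "polybounded {z. snd z \<le> N (fst z)} (\<lambda>z. bitsize ((g ^^ snd z) (f (fst z))))
        (\<lambda>z. bitsize (fst z))"
    and continue: "\<And>x k. k < N x \<Longrightarrow> b ((g ^^ k) (f x))"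
    and stop: "\<And>x. \<not> b ((g ^^ N x) (f x))"
  shows "polytime (\<lambda>x. (g ^^ N x) (f x))"
proof -
  obtain a c d where impl: "implements a b" "implements c g" "implements d f"
    using assms(1-3) by (auto simp: polytime_def)
  let ?n = "\<lambda>z. bitsize (fst z)"
  define iter where "iter z k = (g ^^ k) (f (fst z))" for z :: "'b \<times> bool list" and k
  define S where "S z k = main (bits (b (iter z k)) @ bits (iter z k) @ snd z)" for z k
  let ?steps = "{p. fst p \<in> UNIV \<and> snd p < N (fst (fst p))}"
  have size_iter: "polybounded UNIV (\<lambda>z. bitsize (iter z (k z))) ?n" if "\<And>z. k z \<le> N (fst z)" for k
    using polybounded_compose[OF size, of UNIV "\<lambda>z. (fst z, k z)"] that by (simp add: iter_def)
  have size_steps: "polybounded ?steps (\<lambda>p. bitsize (iter (fst p) (k p))) (\<lambda>p. ?n (fst p))"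
    if "\<And>p. p \<in> ?steps \<Longrightarrow> k p \<le> N (fst (fst p))" for k
    using polybounded_compose[OF size, of ?steps "\<lambda>p. (fst (fst p), k p)"] that
    by (simp add: iter_def)
  have iter_Suc: "iter z (Suc k) = g (iter z k)" for z k by (simp add: iter_def)
  have "polyrun UNIV ?n d (\<lambda>z. main (bits (fst z) @ snd z)) (\<lambda>z. main (bits (iter z 0) @ snd z))"
    unfolding iter_def funpow_0 by (intro polyrun_implements impl polybounded_self)
  also have "polyrun UNIV ?n dup_arg \<dots> (\<lambda>z. main (bits (iter z 0) @ bits (iter z 0) @ snd z))"
    by (intro polyrun_dup_arg size_iter) simp
  also have "polyrun UNIV ?n a \<dots> (\<lambda>z. S z 0)"
    unfolding S_def by (intro polyrun_implements impl size_iter) simp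
  also have "polyrun UNIV ?n (While Main (\<lambda>x. x = Some True) (drop_arg ;; c ;; dup_arg ;; a)) \<dots>
      (\<lambda>z. S z (N (fst z)))"
  proof (rule polyrun_While)
    show "polyrun ?steps (\<lambda>p. ?n (fst p)) (drop_arg ;; c ;; dup_arg ;; a)
        (\<lambda>p. S (fst p) (snd p)) (\<lambda>p. S (fst p) (Suc (snd p)))"
      unfolding S_def iter_Suc
      by (intro polyrun_while_body impl assms(1) size_steps
          size_steps[of "\<lambda>p. Suc (snd p)", unfolded iter_Suc]) simp_all
    show "polybounded UNIV (\<lambda>z. N (fst z)) ?n"
      by (rule polybounded_compose[OF N]) simp
  qed (use continue stop in \<open>simp_all add: S_def iter_def\<close>)
  also have "polyrun UNIV ?n drop_arg \<dots> (\<lambda>z. main (bits (iter z (N (fst z))) @ snd z))"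
    unfolding S_def by (intro polyrun_drop_arg polybounded_bitsize[OF assms(1)] size_iter) simp
  finally show ?thesis
    unfolding iter_def by (rule polytimeI)
qed

subsection \<open>Equality test\<close>

definition flag_mismatch :: "stack prog" where
  "flag_mismatch = Cond Pending (\<lambda>x. x = None) (Push Pending True) Skip"

definition compare_tops :: "stack prog" where
  "compare_tops = Cond Aux1 (\<lambda>x. x = Some True)
     (Cond Aux2 (\<lambda>x. x = Some True) Skip flag_mismatch)
     (Cond Aux2 (\<lambda>x. x = Some False) Skip flag_mismatch) ;; Pop Aux1 ;; Pop Aux2"

definition report_match :: "stack prog" where
  "report_match = Cond Pending (\<lambda>x. x = None) (push_list (bits True))
    (Pop Pending ;; push_list (bits False))"

definition equality_test :: "stack prog" where
  "equality_test = Pop Main ;; grab [Aux1] ;; grab [Aux2] ;;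
     While Aux1 (\<lambda>x. x \<noteq> None) compare_tops ;;
     Cond Aux2 (\<lambda>x. x = None) Skip flag_mismatch ;; clear Aux2 ;; report_match"

definition mismatch :: "bool list \<Rightarrow> bool list \<Rightarrow> bool list" where
  "mismatch xs ys = (if xs = ys then [] else [True])"

lemma exec_compare_tops:
  assumes "k < length xs"
  shows "exec compare_tops (state m (drop k xs) (drop k ys) (mismatch (take k xs) (take k ys)))
    = state m (drop (Suc k) xs) (drop (Suc k) ys) (mismatch (take (Suc k) xs) (take (Suc k) ys))"
proof (cases "k < length ys")
  case True
  then have "drop k xs = xs ! k # drop (Suc k) xs" "drop k ys = ys ! k # drop (Suc k) ys"
    "take (Suc k) xs = take k xs @ [xs ! k]" "take (Suc k) ys = take k ys @ [ys ! k]"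
    using assms by (simp_all add: Cons_nth_drop_Suc take_Suc_conv_app_nth)
  then show ?thesis
    by (simp add: compare_tops_def flag_mismatch_def mismatch_def)
next
  case False
  then have "length (take (Suc k) xs) \<noteq> length ys" using assms by simp
  then have "take (Suc k) xs \<noteq> ys" by metis
  moreover have "drop k xs = xs ! k # drop (Suc k) xs"
    using assms by (simp add: Cons_nth_drop_Suc)
  ultimately show ?thesis using False
    by (simp add: compare_tops_def flag_mismatch_def mismatch_def)
qed

lemma polyrun_compare_loop:
  assumes "polybounded X (\<lambda>z. length (xs z)) n"
  shows "polyrun X n (While Aux1 (\<lambda>x. x \<noteq> None) compare_tops) (\<lambda>z. state (r z) (xs z) (ys z) [])
    (\<lambda>z. state (r z) [] (drop (length (xs z)) (ys z))
      (mismatch (xs z) (take (length (xs z)) (ys z))))"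
proof -
  define S where "S z k = state (r z) (drop k (xs z)) (drop k (ys z))
      (mismatch (take k (xs z)) (take k (ys z)))" for z k
  have "polyrun X n (While Aux1 (\<lambda>x. x \<noteq> None) compare_tops) (\<lambda>z. S z 0) (\<lambda>z. S z (length (xs z)))"
  proof (rule polyrun_While[OF polyrun_exec assms])
    show "loop_free compare_tops" by (simp add: compare_tops_def flag_mismatch_def)
    show "peek (S z k Aux1) \<noteq> None" if "k < length (xs z)" for z k
      using that by (simp add: S_def Cons_nth_drop_Suc[symmetric])
  qed (simp_all add: S_def exec_compare_tops)
  then show ?thesis by (simp add: S_def mismatch_def)
qed

lemma exec_flag_rest:
  "exec (Cond Aux2 (\<lambda>x. x = None) Skip flag_mismatch)
     (state m [] (drop (length xs) ys) (mismatch xs (take (length xs) ys)))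
   = state m [] (drop (length xs) ys) (mismatch xs ys)"
proof (cases "drop (length xs) ys")
  case Nil
  then have "take (length xs) ys = ys" by simp
  with Nil show ?thesis by (simp only: exec.simps) simp
next
  case (Cons y zs)
  then have "xs \<noteq> ys" by auto
  with Cons show ?thesis by (simp add: flag_mismatch_def mismatch_def)
qed

lemma implements_equality_test: "implements equality_test (\<lambda>z. fst z = snd (z :: 'a::data \<times> 'a))"
proof -
  let ?n = "\<lambda>z. bitsize (fst z :: 'a \<times> 'a)"
  define u v where "u z = rev (bits (fst (fst z)))" and "v z = rev (bits (snd (fst z)))"
    for z :: "('a \<times> 'a) \<times> bool list"
  define rest where "rest z = drop (length (u z)) (v z)" for z
  have size: "polybounded UNIV (\<lambda>z. length (u z)) ?n" "polybounded UNIV (\<lambda>z. length (v z)) ?n"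
    using polybounded_bitsize_pair[of UNIV fst] by (simp_all add: u_def v_def bitsize_def)
  note polyrun_open_pair
  also have "polyrun UNIV ?n (grab [Aux1])
      (\<lambda>z. main (bits (fst (fst z)) @ bits (snd (fst z)) @ snd z))
      (\<lambda>z. state (bits (snd (fst z)) @ snd z) (u z) [] [])"
    by (rule polyrun_cong[OF polyrun_grab_bits[OF _ _ _ polybounded_bitsize_pair(1)]])
      (auto simp: u_def)
  also have "polyrun UNIV ?n (grab [Aux2]) \<dots> (\<lambda>z. state (snd z) (u z) (v z) [])"
    by (rule polyrun_cong[OF polyrun_grab_bits[OF _ _ _ polybounded_bitsize_pair(2)]])
      (auto simp: v_def)
  also note polyrun_compare_loop[OF size(1)]
  also have "polyrun UNIV ?n (Cond Aux2 (\<lambda>x. x = None) Skip flag_mismatch)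
      (\<lambda>z. state (snd z) [] (drop (length (u z)) (v z))
        (mismatch (u z) (take (length (u z)) (v z))))
      (\<lambda>z. state (snd z) [] (rest z) (mismatch (u z) (v z)))"
    unfolding rest_def by (rule polyrun_exec[OF _ exec_flag_rest]) (simp add: flag_mismatch_def)
  also have "polyrun UNIV ?n (clear Aux2) \<dots> (\<lambda>z. state (snd z) [] [] (mismatch (u z) (v z)))"
  proof (rule polyrun_cong[OF polyrun_clear])
    show "polybounded UNIV (\<lambda>z. length (state (snd z) [] (rest z) (mismatch (u z) (v z)) Aux2)) ?n"
      by (rule polybounded_mono[OF size(2)]) (simp add: rest_def)
  qed simp_all
  also have "polyrun UNIV ?n report_match \<dots> (\<lambda>z. main (bits (fst (fst z) = snd (fst z)) @ snd z))"
    by (rule polyrun_exec) (auto simp: report_match_def mismatch_def u_def v_def bits_inject)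
  finally show ?thesis
    unfolding equality_test_def implements_def .
qed

lemma polytime_eq [polytime_intros]:
  assumes "polytime f" "polytime g"
  shows "polytime (\<lambda>x. f x = g x)"
  using polytime_comp[of "\<lambda>z. fst z = snd z", OF _ polytime_Pair[OF assms]] implements_equality_test
  by (auto simp: polytime_def)

lemma polytime_uncurry3:
  assumes "polytime (\<lambda>(x, y, z). h x y z)" "polytime f" "polytime g" "polytime k"
  shows "polytime (\<lambda>x. h (f x) (g x) (k x))"
  using polytime_comp[OF assms(1) polytime_Pair[OF assms(2) polytime_Pair[OF assms(3,4)]]] by simp

lemma polytime_Not [polytime_intros]: "polytime f \<Longrightarrow> polytime (\<lambda>x. \<not> f x)"
  using polytime_eq[OF _ polytime_const[of False]] by simp

lemma polytime_conj [polytime_intros]: "polytime f \<Longrightarrow> polytime g \<Longrightarrow> polytime (\<lambda>x. f x \<and> g x)"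
  using polytime_If[OF _ _ polytime_const[of False], of f g] by (simp add: if_bool_eq_disj)

lemma polytime_disj [polytime_intros]: "polytime f \<Longrightarrow> polytime g \<Longrightarrow> polytime (\<lambda>x. f x \<or> g x)"
  using polytime_Not[OF polytime_conj[OF polytime_Not polytime_Not]] by simp

subsection \<open>From polynomial-time functions to Turing machines\<close>

definition load_bit :: "stack prog" where
  "load_bit = Cond Aux1 (\<lambda>x. x = Some True) (push_list (True # bits True))
    (push_list (True # bits False)) ;; Pop Aux1"

definition unload_bit :: "stack prog" where
  "unload_bit = Pop Main ;; Cond Main (\<lambda>x. x = Some True)
     (Pop Main ;; Pop Main ;; Pop Main ;; Push Aux1 True)
     (Pop Main ;; Push Aux1 False)"

definition load :: "stack prog" where
  "load = Push Main False ;; While Aux1 (\<lambda>x. x \<noteq> None) load_bit"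

definition unload :: "stack prog" where
  "unload = While Main (\<lambda>x. x = Some True) unload_bit ;; Pop Main"

lemma io_store_Aux1: "io_store Aux1 w = state [] (rev w) [] []"
  by (auto simp: io_store_def state_def fun_eq_iff split: stack.split)

lemma polyrun_load: "polyrun UNIV length load (io_store Aux1) (\<lambda>w. main (bits w))"
proof -
  define S where "S w k = state (bits (drop (length w - k) w)) (rev (take (length w - k) w)) [] []"
      for w :: "bool list" and k
  have "polyrun UNIV length (Push Main False) (io_store Aux1) (\<lambda>w. S w 0)"
    by (rule polyrun_exec) (auto simp: io_store_Aux1 S_def)
  also have "polyrun UNIV length (While Aux1 (\<lambda>x. x \<noteq> None) load_bit)
      \<dots> (\<lambda>w. S w (length w))"
  proof (rule polyrun_While[OF polyrun_exec polybounded_self])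
    fix z :: "bool list \<times> nat"
    assume "z \<in> {z. fst z \<in> UNIV \<and> snd z < length (fst z)}"
    then obtain w k where z_eq: "z = (w, k)" "k < length w" by (cases z) auto
    define j where "j = length w - Suc k"
    have j_eqs: "length w - k = Suc j" "length w - Suc k = j" "j < length w"
      using z_eq(2) by (auto simp: j_def)
    show "exec load_bit (S (fst z) (snd z)) = S (fst z) (Suc (snd z))"
      by (cases "w ! j")
        (simp_all add: load_bit_def z_eq(1) S_def j_eqs take_Suc_conv_app_nth
          Cons_nth_drop_Suc[symmetric])
  next
    fix w :: "bool list" and k
    assume "k < length w"
    then show "peek (S w k Aux1) \<noteq> None"
      by (cases "rev (take (length w - k) w)") (auto simp: S_def)
  qed (simp_all add: load_bit_def S_def)
  finally show ?thesis
    unfolding load_def by (simp add: S_def)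
qed

lemma polyrun_unload: "polyrun UNIV length unload (\<lambda>w. main (bits w)) (io_store Aux1)"
proof -
  define S where "S w k = state (bits (drop k w)) (rev (take k w)) [] []" for w :: "bool list" and k
  have "polyrun UNIV length (While Main (\<lambda>x. x = Some True) unload_bit) (\<lambda>w. S w 0)
      (\<lambda>w. S w (length w))"
  proof (rule polyrun_While[OF polyrun_exec polybounded_self])
    fix z :: "bool list \<times> nat"
    assume "z \<in> {z. fst z \<in> UNIV \<and> snd z < length (fst z)}"
    then obtain w k where z_eq: "z = (w, k)" "k < length w" by (cases z) auto
    then show "exec unload_bit (S (fst z) (snd z)) = S (fst z) (Suc (snd z))"
      by (cases "w ! k")
        (simp_all add: unload_bit_def S_def take_Suc_conv_app_nth Cons_nth_drop_Suc[symmetric])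
  qed (auto simp: unload_bit_def S_def Cons_nth_drop_Suc[symmetric])
  also have "polyrun UNIV length (Pop Main) \<dots> (io_store Aux1)"
    by (rule polyrun_exec) (auto simp: io_store_Aux1 S_def)
  finally show ?thesis
    unfolding unload_def by (simp add: S_def)
qed

lemma bitsize_bool_list: "bitsize (w :: bool list) \<le> 4 * length w + 1" "length w \<le> bitsize w"
proof -
  show "bitsize w \<le> 4 * length w + 1"
  proof (induction w)
    case (Cons b w)
    then show ?case by (cases b) auto
  qed simp
  show "length w \<le> bitsize w" by (induction w) auto
qed

theorem tm_computes_if_polytime:
  fixes f :: "bool list \<Rightarrow> bool list"
  assumes "polytime f"
  obtains M a b where "wf_tm M" "\<And>w. \<exists>t \<le> a * length w ^ b + a. tm_computes_within M w (f w) t"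
proof -
  obtain c where impl: "implements c f" using assms by (auto simp: polytime_def)
  have size: "polybounded UNIV (\<lambda>w :: bool list. bitsize w) length"
  proof (rule polybounded_mono)
    show "polybounded UNIV (\<lambda>w :: bool list. 4 * length w + 1) length" by (intro polybounded_intros)
  qed (rule bitsize_bool_list)
  note polyrun_load
  also have "polyrun UNIV length c (\<lambda>w. main (bits w)) (\<lambda>w. main (bits (f w)))"
    using polyrun_implements[OF impl size, of "\<lambda>_. []"] by simp
  also have "polyrun UNIV length unload \<dots> (\<lambda>w. io_store Aux1 (f w))"
  proof (rule polyrun_measure)
    show "polyrun UNIV (\<lambda>w. length (f w)) unload (\<lambda>w. main (bits (f w))) (\<lambda>w. io_store Aux1 (f w))"
      by (rule polyrun_compose[OF polyrun_unload]) simp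
    show "polybounded UNIV (\<lambda>w. length (f w)) length"
      by (rule polybounded_mono[OF polybounded_bitsize[OF assms size] bitsize_bool_list(2)])
  qed
  finally obtain T where T: "polybounded UNIV T length"
      "\<And>w. runs (load ;; c ;; unload) (io_store Aux1 w) (T w) (io_store Aux1 (f w))"
    unfolding polyrun_def by auto
  obtain M where M: "wf_tm M"
    "\<And>w v t. runs (load ;; c ;; unload) (io_store Aux1 w) t (io_store Aux1 v) \<Longrightarrow>
      \<exists>u \<le> t * (2 * (length w + t) + 4) + 2. tm_computes_within M w v u"
    using tm_computes_if_runs[of "load ;; c ;; unload" Aux1] by blast
  have "polybounded UNIV (\<lambda>w. T w * (2 * (length w + T w) + 4) + 2) length"
    by (intro polybounded_intros T)
  then obtain a b where "\<And>w. T w * (2 * (length w + T w) + 4) + 2 \<le> a * length w ^ b + a"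
    by (rule polybounded_monomial) auto
  then have "\<exists>t \<le> a * length w ^ b + a. tm_computes_within M w (f w) t" for w
    using M(2)[OF T(2)] le_trans by blast
  with M(1) show thesis by (rule that)
qed

subsection \<open>List processing\<close>

lemma length_le_bitsize: "length xs \<le> bitsize xs"
  by (induction xs) auto

lemma bitsize_le_bitsize_list: "y \<in> set ys \<Longrightarrow> bitsize y \<le> bitsize ys"
  by (induction ys) auto

lemma bitsize_append: "Suc (bitsize (xs @ ys)) = bitsize xs + bitsize ys"
  by (induction xs) auto

lemma bitsize_drop: "bitsize (drop k xs) \<le> bitsize xs"
proof (induction xs arbitrary: k)
  case (Cons x xs)
  then show ?case by (cases k) (auto intro: le_SucI trans_le_add2)
qed simp

lemma bitsize_bool: "bitsize (b :: bool) \<le> 3"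
  by (cases b) auto

lemma bitsize_fold_le:
  assumes "\<And>y a. y \<in> set ys \<Longrightarrow> I a \<Longrightarrow> I (h y a) \<and> bitsize (h y a) \<le> bitsize a + m" "I a"
  shows "bitsize (fold h ys a) \<le> bitsize a + length ys * m"
  using assms
proof (induction ys arbitrary: a)
  case (Cons y ys)
  have "bitsize (fold h ys (h y a)) \<le> bitsize (h y a) + length ys * m"
    using Cons.prems by (intro Cons.IH) auto
  also have "\<dots> \<le> bitsize a + m + length ys * m" using Cons.prems by simp
  finally show ?case by simp
qed simp

lemma polybounded_bitsize_fold_take:
  assumes xs: "polytime xs" and ini: "polytime ini"
    and growth: "polybounded UNIV q bitsize"
    and init: "\<And>x. I x (ini x)"
    and step: "\<And>x y a. I x a \<Longrightarrow> I x (h x y a) \<and> bitsize (h x y a) \<le> bitsize a + q (x, y)"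
  shows "polybounded X (\<lambda>z. bitsize (fold (h (fst z)) (take (snd z) (xs (fst z))) (ini (fst z))))
      (\<lambda>z. bitsize (fst z))"
proof -
  obtain a b where q_le: "\<And>z. q z \<le> a * Suc (bitsize z) ^ b"
    using growth unfolding polybounded_def by blast
  define m where "m x = a * Suc (Suc (bitsize x + bitsize (xs x))) ^ b" for x
  have bound: "bitsize (fold (h x) (take k (xs x)) (ini x))
      \<le> bitsize (ini x) + bitsize (xs x) * m x" for x k
  proof -
    have "q (x, y) \<le> m x" if "y \<in> set (take k (xs x))" for y
    proof -
      have "bitsize (x, y) \<le> Suc (bitsize x + bitsize (xs x))"
        using bitsize_le_bitsize_list[OF in_set_takeD[OF that]] by simp
      then have "a * Suc (bitsize (x, y)) ^ b \<le> m x"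
        unfolding m_def by (intro mult_le_mono2 power_mono) simp_all
      with q_le[of "(x, y)"] show ?thesis by (rule le_trans)
    qed
    then have "I x (h x y a) \<and> bitsize (h x y a) \<le> bitsize a + m x"
      if "y \<in> set (take k (xs x))" "I x a" for y a
      using step[OF that(2), of y] that(1) by (meson add_left_mono le_trans)
    then have "bitsize (fold (h x) (take k (xs x)) (ini x))
        \<le> bitsize (ini x) + length (take k (xs x)) * m x"
      using init by (rule bitsize_fold_le)
    also have "\<dots> \<le> bitsize (ini x) + bitsize (xs x) * m x"
      using length_le_bitsize[of "xs x"] by (intro add_left_mono mult_le_mono1) simp
    finally show ?thesis .
  qed
  have "polybounded X (\<lambda>z. bitsize (ini (fst z)) + bitsize (xs (fst z)) * m (fst z))
      (\<lambda>z. bitsize (fst z))"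
    unfolding m_def
    by (intro polybounded_intros polybounded_bitsize[OF xs polybounded_self]
      polybounded_bitsize[OF ini polybounded_self])
  then show ?thesis using bound by (rule polybounded_mono)
qed

definition fold_step :: "('a \<Rightarrow> 'b \<Rightarrow> 'c \<Rightarrow> 'c) \<Rightarrow> 'a \<times> 'b list \<times> 'c \<Rightarrow> 'a \<times> 'b list \<times> 'c" where
  "fold_step h = (\<lambda>(x, ys, a). case ys of [] \<Rightarrow> (x, ys, a) | y # ys' \<Rightarrow> (x, ys', h x y a))"

lemma funpow_fold_step:
  "k \<le> length ys \<Longrightarrow> (fold_step h ^^ k) (x, ys, a) = (x, drop k ys, fold (h x) (take k ys) a)"
proof (induction k)
  case (Suc k)
  then have "drop k ys = ys ! k # drop (Suc k) ys" "take (Suc k) ys = take k ys @ [ys ! k]"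
    by (simp_all add: Cons_nth_drop_Suc take_Suc_conv_app_nth)
  then show ?case using Suc by (simp add: fold_step_def)
qed simp

lemma polytime_fold_invariant:
  fixes h :: "'a::data \<Rightarrow> 'b::data \<Rightarrow> 'c::data \<Rightarrow> 'c"
  assumes xs: "polytime xs" and ini: "polytime ini" and h: "polytime (\<lambda>(x, y, a). h x y a)"
    and growth: "polybounded UNIV q bitsize"
    and init: "\<And>x. I x (ini x)"
    and step: "\<And>x y a. I x a \<Longrightarrow> I x (h x y a) \<and> bitsize (h x y a) \<le> bitsize a + q (x, y)"
  shows "polytime (\<lambda>x. fold (h x) (xs x) (ini x))"
proof -
  let ?pending = "\<lambda>(x :: 'a, ys :: 'b list, a :: 'c). ys \<noteq> []"
  have "polytime (\<lambda>x. (fold_step h ^^ length (xs x)) (x, xs x, ini x))"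
  proof (rule polytime_while)
    show "polytime ?pending" by (intro polytime_intros)
    show "polytime (fold_step h)"
      unfolding fold_step_def by (intro polytime_intros polytime_uncurry3[OF h])
    let ?X = "{z. snd z \<le> length (xs (fst z))}"
    show "polytime (\<lambda>x. (x, xs x, ini x))" by (intro polytime_intros xs ini)
    show "polybounded UNIV (\<lambda>x. length (xs x)) bitsize"
      by (rule polybounded_mono[OF polybounded_bitsize[OF xs polybounded_self] length_le_bitsize])
    have "polybounded ?X (\<lambda>z. Suc (bitsize (fst z) + Suc (bitsize (xs (fst z)) +
        bitsize (fold (h (fst z)) (take (snd z) (xs (fst z))) (ini (fst z))))))
        (\<lambda>z. bitsize (fst z))"
      by (intro polybounded_intros polybounded_bitsize[OF xs polybounded_self]
          polybounded_bitsize_fold_take[OF xs ini growth init step])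
    then show "polybounded ?X
        (\<lambda>z. bitsize ((fold_step h ^^ snd z) (fst z, xs (fst z), ini (fst z))))
        (\<lambda>z. bitsize (fst z))"
      by (rule polybounded_mono) (simp add: funpow_fold_step bitsize_drop)
    show "?pending ((fold_step h ^^ k) (x, xs x, ini x))" if "k < length (xs x)" for x k
      using that by (simp add: funpow_fold_step)
    show "\<not> ?pending ((fold_step h ^^ length (xs x)) (x, xs x, ini x))" for x
      by (simp add: funpow_fold_step)
  qed
  then have "polytime (\<lambda>x. snd (snd ((fold_step h ^^ length (xs x)) (x, xs x, ini x))))"
    by (intro polytime_intros)
  then show ?thesis by (simp add: funpow_fold_step)
qed

lemmas polytime_fold = polytime_fold_invariant[where I = "\<lambda>_ _. True", simplified]

lemma polytime_rev [polytime_intros]: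
  fixes f :: "'a::data \<Rightarrow> 'b::data list"
  assumes "polytime f"
  shows "polytime (\<lambda>x. rev (f x))"
proof -
  have "polytime (\<lambda>x. fold (\<lambda>y a. y # a) (f x) [])"
  proof (rule polytime_fold)
    show "bitsize (y # a) \<le> bitsize a + bitsize (x, y)" for x :: 'a and y :: 'b and a by simp
  qed (intro polytime_intros polybounded_intros assms)+
  then show ?thesis by (simp add: rev_conv_fold)
qed

lemma polytime_foldr:
  assumes "polytime xs" "polytime ini" "polytime (\<lambda>(x, y, a). h x y a)" "polybounded UNIV q bitsize"
    and "\<And>x y a. bitsize (h x y a) \<le> bitsize a + q (x, y)"
  shows "polytime (\<lambda>x. foldr (h x) (xs x) (ini x))"
  unfolding foldr_conv_fold by (rule polytime_fold[OF polytime_rev]) (rule assms)+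

lemma polytime_append [polytime_intros]:
  fixes f g :: "'a::data \<Rightarrow> 'b::data list"
  assumes "polytime f" "polytime g"
  shows "polytime (\<lambda>x. f x @ g x)"
proof -
  have "polytime (\<lambda>x. foldr (\<lambda>y a. y # a) (f x) (g x))"
  proof (rule polytime_foldr)
    show "bitsize (y # a) \<le> bitsize a + bitsize (x, y)" for x :: 'a and y :: 'b and a by simp
  qed (intro polytime_intros polybounded_intros assms)+
  moreover have "foldr (\<lambda>y a. y # a) xs ys = xs @ ys" for xs ys :: "'b list" by (induction xs) auto
  ultimately show ?thesis by simp
qed

lemma polytime_concat [polytime_intros]:
  fixes f :: "'a::data \<Rightarrow> 'b::data list list"
  assumes "polytime f"
  shows "polytime (\<lambda>x. concat (f x))"
  unfolding concat_conv_foldr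
proof (rule polytime_foldr)
  show "bitsize (y @ a) \<le> bitsize a + bitsize (x, y)" for x :: 'a and y a :: "'b list"
    using bitsize_append[of y a] by simp
qed (intro polytime_intros polybounded_intros assms)+

lemma polytime_map [polytime_intros]:
  fixes f :: "'a::data \<Rightarrow> 'b::data list" and h :: "'a \<Rightarrow> 'b \<Rightarrow> 'c::data"
  assumes "polytime f" and h: "polytime (\<lambda>(x, y). h x y)"
  shows "polytime (\<lambda>x. map (h x) (f x))"
proof -
  have "polytime (\<lambda>x. foldr (\<lambda>y a. h x y # a) (f x) [])"
  proof (rule polytime_foldr)
    show "polybounded UNIV (\<lambda>z. Suc (bitsize (case z of (x, y) \<Rightarrow> h x y))) bitsize"
      by (intro polybounded_intros polybounded_bitsize[OF h])
    show "bitsize (h x y # a) \<le> bitsize a + Suc (bitsize (case (x, y) of (x, y) \<Rightarrow> h x y))"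
      for x y a by simp
  qed (intro polytime_intros polytime_uncurry[OF h] assms)+
  moreover have "foldr (\<lambda>y a. k y # a) xs [] = map k xs" for k :: "'b \<Rightarrow> 'c" and xs
    by (induction xs) auto
  ultimately show ?thesis by simp
qed

lemma polytime_filter [polytime_intros]:
  fixes f :: "'a::data \<Rightarrow> 'b::data list"
  assumes "polytime f" and P: "polytime (\<lambda>(x, y). P x y)"
  shows "polytime (\<lambda>x. filter (P x) (f x))"
proof -
  have "polytime (\<lambda>x. foldr (\<lambda>y a. if P x y then y # a else a) (f x) [])"
  proof (rule polytime_foldr)
    show "bitsize (if P x y then y # a else a) \<le> bitsize a + bitsize (x, y)" for x y a by simp
  qed (intro polytime_intros polybounded_intros polytime_uncurry[OF P] assms)+
  moreover have "foldr (\<lambda>y a. if Q y then y # a else a) xs [] = filter Q xs"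
    for Q and xs :: "'b list"
    by (induction xs) auto
  ultimately show ?thesis by simp
qed

lemma polytime_member [polytime_intros]:
  fixes f :: "'a::data \<Rightarrow> 'b::data"
  assumes "polytime f" "polytime g"
  shows "polytime (\<lambda>x. f x \<in> set (g x))"
proof -
  have "polytime (\<lambda>x. filter (\<lambda>y. y = f x) (g x) \<noteq> [])"
    by (intro polytime_intros assms polytime_comp[OF assms(1)])
  then show ?thesis by (simp add: filter_empty_conv)
qed

lemma polytime_remdups [polytime_intros]:
  fixes f :: "'a::data \<Rightarrow> 'b::data list"
  assumes "polytime f"
  shows "polytime (\<lambda>x. remdups (f x))"
proof -
  have "polytime (\<lambda>x. foldr (\<lambda>y a. if y \<in> set a then a else y # a) (f x) [])"
  proof (rule polytime_foldr)
    show "bitsize (if y \<in> set a then a else y # a) \<le> bitsize a + bitsize (x, y)"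
      for x :: 'a and y :: 'b and a by simp
  qed (intro polytime_intros polybounded_intros assms)+
  moreover have "foldr (\<lambda>y a. if y \<in> set a then a else y # a) xs [] = remdups xs"
    for xs :: "'b list"
    by (induction xs) auto
  ultimately show ?thesis by simp
qed

subsection \<open>Binary numbers\<close>

declare bin.simps [simp del]

lemma bin_0 [simp]: "bin 0 = []"
  by (simp add: bin.simps)

lemma bin_pos: "0 < n \<Longrightarrow> bin n = odd n # bin (n div 2)"
  by (simp add: bin.simps[of n])

primrec bval :: "bool list \<Rightarrow> nat" where
  "bval [] = 0"
| "bval (b # bs) = of_bool b + 2 * bval bs"

lemma bval_bin [simp]: "bval (bin n) = n"
proof (induction n rule: bin.induct)
  case (1 n)
  then show ?case by (cases "n = 0") (auto simp: bin_pos)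
qed

lemma bval_append: "bval (xs @ ys) = bval xs + 2 ^ length xs * bval ys"
  by (induction xs) (auto simp: algebra_simps)

lemma bval_eq_0_iff: "bval bs = 0 \<longleftrightarrow> True \<notin> set bs"
  by (induction bs) auto

lemma bin_bval: "bin (bval bs) = foldr (\<lambda>b a. if \<not> b \<and> a = [] then [] else b # a) bs []"
proof (induction bs)
  case (Cons b bs)
  have "bin (bval (b # bs)) = (if \<not> b \<and> bin (bval bs) = [] then [] else b # bin (bval bs))"
    by (cases "bval bs = 0") (auto simp: bin_pos)
  then show ?case using Cons by simp
qed simp

lemma length_bin_le_iff: "length (bin n) \<le> k \<longleftrightarrow> n < 2 ^ k"
proof (induction k arbitrary: n)
  case 0
  show ?case by (cases "n = 0") (auto simp: bin_pos)
next
  case (Suc k)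
  show ?case
    using Suc[of "n div 2"] by (cases "n = 0") (auto simp: bin_pos less_mult_imp_div_less)
qed

instantiation nat :: data
begin
definition to_tree_nat :: "nat \<Rightarrow> tree" where
  "to_tree_nat n = to_tree (bin n)"
instance by standard (metis bval_bin injI to_tree_inject to_tree_nat_def)
end

lemma bits_nat: "bits n = bits (bin n)"
  by (simp add: bits_def to_tree_nat_def)

lemma polytime_bin [polytime_intros]: "polytime f \<Longrightarrow> polytime (\<lambda>x. bin (f x))"
  by (erule polytime_cong_bits) (simp only: bits_nat)

lemma polytime_if_bin: "polytime (\<lambda>x. bin (f x)) \<Longrightarrow> polytime f"
  by (erule polytime_cong_bits) (simp only: bits_nat)

lemma polytime_bval [polytime_intros]:
  assumes "polytime f"
  shows "polytime (\<lambda>x. bval (f x))"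
proof (rule polytime_if_bin, unfold bin_bval, rule polytime_foldr)
  show "bitsize (if \<not> b \<and> a = [] then [] else b # a) \<le> bitsize a + bitsize (x, b)"
    for x :: 'a and b a
    by simp
qed (intro polytime_intros polybounded_intros assms)+

definition carry_step :: "bool \<Rightarrow> bool \<times> bool list \<Rightarrow> bool \<times> bool list" where
  "carry_step b = (\<lambda>(c, a). (c \<and> b, (c \<noteq> b) # a))"

lemma bval_carry:
  "(case fold carry_step bs (c, a) of (c', a') \<Rightarrow> bval (rev a' @ [c']))
    = bval (rev a) + 2 ^ length a * (of_bool c + bval bs)"
proof (induction bs arbitrary: c a)
  case (Cons b bs)
  show ?case
    using Cons[of "c \<and> b" "(c \<noteq> b) # a"]
    by (cases b; cases c) (simp_all add: carry_step_def bval_append algebra_simps)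
qed (simp add: bval_append)

lemma polytime_Suc [polytime_intros]:
  assumes "polytime f"
  shows "polytime (\<lambda>x. Suc (f x))"
proof -
  have "polytime (\<lambda>x. fold carry_step (bin (f x)) (True, []))"
  proof (rule polytime_fold)
    show "bitsize (carry_step b s) \<le> bitsize s + 7" for b s
      using bitsize_bool[of "fst s \<and> b"] bitsize_bool[of "fst s \<noteq> b"]
      by (cases s) (simp add: carry_step_def)
  qed (unfold carry_step_def, (intro polytime_intros polybounded_intros assms)+)
  then have "polytime (\<lambda>x. case fold carry_step (bin (f x)) (True, []) of (c', a')
      \<Rightarrow> bval (rev a' @ [c']))"
    by (intro polytime_intros)
  then show ?thesis by (simp add: bval_carry)
qed

lemma bitsize_Suc_nat: "bitsize (Suc n) \<le> bitsize n + 4"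
proof -
  have "bitsize (bin (Suc n)) \<le> bitsize (bin n) + 4"
  proof (induction n rule: bin.induct)
    case (1 n)
    then show ?case by (cases "n = 0"; cases "odd n") (auto simp: bin_pos)
  qed
  then show ?thesis by (simp add: bitsize_def bits_nat)
qed

lemma polytime_length [polytime_intros]:
  fixes f :: "'a::data \<Rightarrow> 'b::data list"
  assumes "polytime f"
  shows "polytime (\<lambda>x. length (f x))"
proof -
  have "polytime (\<lambda>x. fold (\<lambda>_ n. Suc n) (f x) 0)"
    by (rule polytime_fold[where q = "\<lambda>_. 4"])
      (intro polytime_intros polybounded_intros bitsize_Suc_nat assms)+
  moreover have "fold (\<lambda>_ n. Suc n) xs k = k + length xs" for k and xs :: "'b list"
    by (induction xs arbitrary: k) auto
  ultimately show ?thesis by simp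
qed

lemma polytime_two_power_length:
  assumes "polytime f"
  shows "polytime (\<lambda>x. 2 ^ length (f x) :: nat)"
proof -
  have "polytime (\<lambda>x. bval (map (\<lambda>_. False) (f x) @ [True]))"
    by (intro polytime_intros assms)
  moreover have "bval (map (\<lambda>_. False) xs @ [True]) = 2 ^ length xs" for xs :: "'b list"
    by (induction xs) auto
  ultimately show ?thesis by simp
qed

definition less_step :: "bool \<Rightarrow> bool \<times> bool list \<Rightarrow> bool \<times> bool list" where
  "less_step x = (\<lambda>(c, ys). case ys of
     [] \<Rightarrow> (c \<and> \<not> x, [])
   | y # ys' \<Rightarrow> (if x = y then c else y, ys'))"

lemma fold_less_step:
  "(case fold less_step xs (c, ys) of (c', zs) \<Rightarrow> c' \<or> True \<in> set zs)
    \<longleftrightarrow> bval xs < bval ys \<or> bval xs = bval ys \<and> c"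
proof (induction xs arbitrary: c ys)
  case Nil
  show ?case using bval_eq_0_iff[of ys] by auto
next
  case (Cons x xs)
  show ?case
  proof (cases ys)
    case Nil
    then show ?thesis using Cons[of "c \<and> \<not> x" "[]"] by (auto simp: less_step_def)
  next
    case (Cons y zs)
    then show ?thesis using Cons.IH[of "if x = y then c else y" zs]
      by (cases x; cases y) (auto simp: less_step_def)
  qed
qed

lemma polytime_less_nat [polytime_intros]:
  fixes f g :: "'a::data \<Rightarrow> nat"
  assumes "polytime f" "polytime g"
  shows "polytime (\<lambda>x. f x < g x)"
proof -
  have "polytime (\<lambda>x. fold less_step (bin (f x)) (False, bin (g x)))"
  proof (rule polytime_fold)
    show "bitsize (less_step x s) \<le> bitsize s + 3" for x s
    proof (cases "snd s")
      case Nil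
      then show ?thesis using bitsize_bool[of "fst s \<and> \<not> x"] by (cases s) (simp add: less_step_def)
    next
      case (Cons y ys)
      then show ?thesis
        using bitsize_bool[of "if x = y then fst s else y"] by (cases s) (simp add: less_step_def)
    qed
  qed (unfold less_step_def, (intro polytime_intros polybounded_intros assms)+)
  then have "polytime (\<lambda>x. case fold less_step (bin (f x)) (False, bin (g x)) of (c', zs)
      \<Rightarrow> c' \<or> True \<in> set zs)"
    by (intro polytime_intros)
  then show ?thesis by (simp add: fold_less_step)
qed

lemma polytime_min_nat [polytime_intros]:
  fixes f g :: "'a::data \<Rightarrow> nat"
  assumes "polytime f" "polytime g"
  shows "polytime (\<lambda>x. min (f x) (g x))"
proof -
  have "polytime (\<lambda>x. if f x < g x then f x else g x)"
    by (intro polytime_intros assms)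
  moreover have "(if m < n then m else n) = min m n" for m n :: nat by (simp add: min_def)
  ultimately show ?thesis by simp
qed

instantiation int :: data
begin
definition to_tree_int :: "int \<Rightarrow> tree" where
  "to_tree_int i = to_tree (i < 0, nat \<bar>i\<bar>)"
instance by standard (auto simp: inj_def to_tree_int_def)
end

lemma bits_int: "bits i = bits (i < 0, nat \<bar>i\<bar>)"
  by (simp only: bits_def to_tree_int_def)

definition signed :: "bool \<Rightarrow> nat \<Rightarrow> int" where
  "signed s n = (if s then - int n else int n)"

lemma polytime_sign_magnitude:
  fixes f :: "'a::data \<Rightarrow> int"
  assumes "polytime f"
  shows polytime_neg: "polytime (\<lambda>x. f x < 0)" and polytime_nat_abs: "polytime (\<lambda>x. nat \<bar>f x\<bar>)"
proof -
  have "polytime (\<lambda>x. (f x < 0, nat \<bar>f x\<bar>))"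
    using assms by (rule polytime_cong_bits) (simp only: bits_int)
  from polytime_fst[OF this] polytime_snd[OF this]
  show "polytime (\<lambda>x. f x < 0)" "polytime (\<lambda>x. nat \<bar>f x\<bar>)" by simp_all
qed

lemma polytime_signed [polytime_intros]:
  assumes "polytime f" "polytime g"
  shows "polytime (\<lambda>x. signed (f x) (g x))"
proof (rule polytime_cong_bits)
  show "polytime (\<lambda>x. (f x \<and> g x \<noteq> 0, g x))" by (intro polytime_intros assms)
  show "bits (signed (f x) (g x)) = bits (f x \<and> g x \<noteq> 0, g x)" for x
    unfolding bits_int by (simp add: signed_def)
qed

lemma polytime_int [polytime_intros]: "polytime f \<Longrightarrow> polytime (\<lambda>x. int (f x))"
  using polytime_signed[OF polytime_const[of False]] by (simp add: signed_def)

lemma polytime_less_int [polytime_intros]: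
  fixes f g :: "'a::data \<Rightarrow> int"
  assumes "polytime f" "polytime g"
  shows "polytime (\<lambda>x. f x < g x)"
proof -
  have "polytime (\<lambda>x. if f x < 0 then \<not> g x < 0 \<or> nat \<bar>g x\<bar> < nat \<bar>f x\<bar>
      else \<not> g x < 0 \<and> nat \<bar>f x\<bar> < nat \<bar>g x\<bar>)"
    by (intro polytime_intros polytime_sign_magnitude assms)
  moreover have "(if i < 0 then \<not> j < 0 \<or> nat \<bar>j\<bar> < nat \<bar>i\<bar>
      else \<not> j < 0 \<and> nat \<bar>i\<bar> < nat \<bar>j\<bar>) \<longleftrightarrow> i < j"
    for i j :: int by auto
  ultimately show ?thesis by simp
qed

subsection \<open>Encoding and decoding instances\<close>

instantiation unit :: data
begin
definition to_tree_unit :: "unit \<Rightarrow> tree" where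
  "to_tree_unit _ = Tip"
instance by standard (simp add: inj_def)
end

instantiation ci_ext :: (data) data
begin
definition to_tree_ci_ext :: "'a ci_scheme \<Rightarrow> tree" where
  "to_tree_ci_ext I = to_tree (nfeat I, pos I, neg I, ci.more I)"
instance by standard (auto simp: inj_def to_tree_ci_ext_def)
end

lemma bits_ci: "bits I = bits (nfeat I, pos I, neg I, ci.more I)"
  by (simp only: bits_def to_tree_ci_ext_def)

lemma polytime_ci_select [polytime_intros]:
  fixes f :: "'a::data \<Rightarrow> ci"
  assumes "polytime f"
  shows "polytime (\<lambda>x. nfeat (f x))" "polytime (\<lambda>x. pos (f x))" "polytime (\<lambda>x. neg (f x))"
proof -
  have fields: "polytime (\<lambda>x. (nfeat (f x), pos (f x), neg (f x), ci.more (f x)))"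
    using assms by (rule polytime_cong_bits) (simp only: bits_ci)
  show "polytime (\<lambda>x. nfeat (f x))" "polytime (\<lambda>x. pos (f x))" "polytime (\<lambda>x. neg (f x))"
    using polytime_fst[OF fields] polytime_fst[OF polytime_snd[OF fields]]
      polytime_fst[OF polytime_snd[OF polytime_snd[OF fields]]] by simp_all
qed

lemma polytime_ci_make [polytime_intros]:
  assumes "polytime f" "polytime g" "polytime h"
  shows "polytime (\<lambda>x. \<lparr>nfeat = f x, pos = g x, neg = h x\<rparr>)"
proof (rule polytime_cong_bits)
  show "polytime (\<lambda>x. (f x, g x, h x, ()))" by (intro polytime_intros assms)
  show "bits \<lparr>nfeat = f x, pos = g x, neg = h x\<rparr> = bits (f x, g x, h x, ())" for x
    by (simp only: bits_ci ci.simps)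
qed

lemma polytime_enc_nat [polytime_intros]: "polytime f \<Longrightarrow> polytime (\<lambda>x. enc_nat (f x))"
  unfolding enc_nat_def by (intro polytime_intros)

lemma polytime_enc_int: "polytime enc_int"
  unfolding enc_int_def[abs_def] by (intro polytime_intros polytime_sign_magnitude)

lemma polytime_enc_list:
  assumes "polytime e" "polytime f"
  shows "polytime (\<lambda>x. enc_list e (f x))"
  unfolding enc_list_def by (intro polytime_intros polytime_comp[OF assms(1)] assms(2))

lemma polytime_enc_inst: "polytime enc_inst"
  unfolding enc_inst_def[abs_def]
  by (intro polytime_intros polytime_enc_list polytime_enc_int)

definition decode_nat_step :: "bool \<times> bool list \<times> bool list \<Rightarrow> bool \<times> bool list \<times> bool list" where
  "decode_nat_step = (\<lambda>(stop, bs, w). if stop then (stop, bs, w) else case w of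
     [] \<Rightarrow> (stop, bs, w)
   | a # w' \<Rightarrow> (case w' of
       [] \<Rightarrow> (stop, bs, w)
     | b # v \<Rightarrow> if a = b then (False, a # bs, v) else (True, bs, v)))"

definition decode_nat :: "bool list \<Rightarrow> nat \<times> bool list" where
  "decode_nat w =
     (case fold (\<lambda>_. decode_nat_step) w (False, [], w) of (stop, bs, v) \<Rightarrow> (bval (rev bs), v))"

lemma decode_nat_step_simps:
  "decode_nat_step (True, s) = (True, s)"
  "decode_nat_step (False, bs, a # b # v) = (if a = b then (False, a # bs, v) else (True, bs, v))"
  by (simp_all add: decode_nat_step_def split_paired_all)

lemma decode_nat_enc_nat: "decode_nat (enc_nat n @ w) = (n, w)"
proof -
  have stopped: "fold (\<lambda>_. decode_nat_step) c (True, s) = (True, s)" for c :: "bool list" and s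
    by (induction c) (simp_all add: decode_nat_step_simps)
  have loop: "fold (\<lambda>_. decode_nat_step) c (False, a, concat (map (\<lambda>b. [b, b]) bs)
      @ False # True # w)
      = (True, rev bs @ a, w)" if "length bs < length c" for c bs a :: "bool list"
    using that
  proof (induction bs arbitrary: a c)
    case Nil
    then show ?case by (cases c) (auto simp: decode_nat_step_simps stopped)
  next
    case (Cons b bs)
    then show ?case by (cases c) (auto simp: decode_nat_step_simps)
  qed
  have "length (bin n) < length (enc_nat n @ w)"
  proof -
    have "length bs \<le> length (concat (map (\<lambda>b. [b, b]) bs))" for bs :: "bool list"
      by (induction bs) auto
    from this[of "bin n"] show ?thesis by (simp add: enc_nat_def)
  qed
  from loop[OF this, of "[]"]
  have "fold (\<lambda>_. decode_nat_step) (enc_nat n @ w) (False, [], enc_nat n @ w)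
      = (True, rev (bin n), w)"
    by (simp add: enc_nat_def del: fold_append)
  then show ?thesis unfolding decode_nat_def by (simp del: fold_append)
qed

lemma fold_measure_le:
  fixes m :: "'b \<Rightarrow> nat"
  assumes "\<And>y s. m (f y s) \<le> m s"
  shows "m (fold f ys s) \<le> m s"
proof (induction ys arbitrary: s)
  case (Cons y ys)
  from le_trans[OF Cons assms] show ?case by simp
qed simp

lemma bitsize_snd_decode_nat: "bitsize (snd (decode_nat w)) \<le> bitsize w"
proof -
  have "bitsize (snd (snd (decode_nat_step s))) \<le> bitsize (snd (snd s))" for s
    by (auto simp: decode_nat_step_def split: prod.split list.split)
  from fold_measure_le[where m = "\<lambda>s. bitsize (snd (snd s))", OF this, of w "(False, [], w)"]
  show ?thesis by (simp add: decode_nat_def case_prod_beta)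
qed

lemma polytime_decode_nat [polytime_intros]:
  assumes "polytime f"
  shows "polytime (\<lambda>x. decode_nat (f x))"
proof -
  have "polytime (\<lambda>x. fold (\<lambda>_. decode_nat_step) (f x) (False, [], f x))"
  proof (rule polytime_fold)
    show "bitsize (decode_nat_step s) \<le> bitsize s + 2" for s
      by (auto simp: decode_nat_step_def split: prod.split list.split)
  qed (unfold decode_nat_step_def, (intro polytime_intros polybounded_intros assms)+)
  then show ?thesis unfolding decode_nat_def by (intro polytime_intros)
qed

definition decode_list_step ::
    "(bool list \<Rightarrow> 'a \<times> bool list) \<Rightarrow> nat \<Rightarrow> nat \<times> 'a list \<times> bool list
      \<Rightarrow> nat \<times> 'a list \<times> bool list" where
  "decode_list_step p n = (\<lambda>(i, xs, w).
     if i = n then (i, xs, w) else case p w of (x, v) \<Rightarrow> (Suc i, x # xs, v))"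

definition decode_list :: "(bool list \<Rightarrow> 'a \<times> bool list) \<Rightarrow> bool list \<Rightarrow> 'a list \<times> bool list" where
  "decode_list p w = (case decode_nat w of (n, v) \<Rightarrow>
     case fold (\<lambda>_. decode_list_step p n) w (0, [], v) of (i, xs, u) \<Rightarrow> (rev xs, u))"

lemma decode_list_enc_list:
  assumes decode: "\<And>x w. p (e x @ w) = (x, w)" and nonempty: "\<And>x. e x \<noteq> []"
  shows "decode_list p (enc_list e xs @ w) = (xs, w)"
proof -
  have loop: "fold (\<lambda>_. decode_list_step p (i + length ys)) c (i, zs, concat (map e ys) @ w)
      = (i + length ys, rev ys @ zs, w)"
    if "length ys \<le> length c" for c :: "bool list" and i ys zs
    using that
  proof (induction c arbitrary: i ys zs)
    case (Cons b c)
    show ?case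
    proof (cases ys)
      case Nil
      then show ?thesis using Cons.IH[of "[]" i zs] by (simp add: decode_list_step_def)
    next
      case (Cons y ys')
      then show ?thesis
        using Cons.IH[of ys' "Suc i" "y # zs"] Cons.prems by (simp add: decode_list_step_def decode)
    qed
  qed simp
  have "length xs \<le> length (concat (map e xs))"
  proof (induction xs)
    case (Cons x xs)
    then show ?case using nonempty[of x] by (cases "e x") auto
  qed simp
  then have "length xs \<le> length (enc_list e xs @ w)" by (simp add: enc_list_def)
  from loop[OF this, of 0 "[]"]
  have "fold (\<lambda>_. decode_list_step p (length xs)) (enc_list e xs @ w) (0, [], concat (map e xs) @ w)
      = (length xs, rev xs, w)"
    by (simp del: fold_append)
  moreover have "decode_nat (enc_list e xs @ w) = (length xs, concat (map e xs) @ w)"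
    by (simp add: enc_list_def decode_nat_enc_nat)
  ultimately show ?thesis unfolding decode_list_def by (simp del: fold_append)
qed

lemma bitsize_snd_decode_list:
  assumes "\<And>w. bitsize (snd (p w)) \<le> bitsize w"
  shows "bitsize (snd (decode_list p w)) \<le> bitsize w"
proof -
  let ?n = "fst (decode_nat w)" and ?rest = "\<lambda>s. bitsize (snd (snd s))"
  have "?rest (decode_list_step p ?n s) \<le> ?rest s" for s
    using assms[of "snd (snd s)"] by (simp add: decode_list_step_def case_prod_beta)
  from fold_measure_le[where m = ?rest, OF this, of w "(0, [], snd (decode_nat w))"]
    bitsize_snd_decode_nat[of w]
  show ?thesis by (simp add: decode_list_def case_prod_beta)
qed

lemma polytime_decode_list:
  fixes p :: "bool list \<Rightarrow> 'a::data \<times> bool list"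
  assumes poly: "polytime p" and rest: "\<And>w. bitsize (snd (p w)) \<le> bitsize w"
  shows "polytime (decode_list p)"
proof -
  let ?h = "\<lambda>w. decode_list_step p (fst (decode_nat w))"
  obtain a b where size_le: "\<And>w. bitsize (p w) \<le> a * Suc (bitsize w) ^ b"
    using polybounded_bitsize[OF poly polybounded_self, of UNIV "\<lambda>w. w"]
    unfolding polybounded_def by blast
  have "polytime (\<lambda>w. fold (\<lambda>_. ?h w) w (0, [], snd (decode_nat w)))"
  proof (rule polytime_fold_invariant)
    show "polybounded UNIV (\<lambda>z. a * Suc (bitsize z) ^ b + 5) (bitsize :: bool list \<times> bool \<Rightarrow> nat)"
      by (intro polybounded_intros)
    show "bitsize (snd (snd (?h w s))) \<le> bitsize w \<and> bitsize (?h w s)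
        \<le> bitsize s + (a * Suc (bitsize (w, y)) ^ b + 5)"
      if "bitsize (snd (snd s)) \<le> bitsize w" for w and y :: bool and s
    proof -
      obtain i xs v where s_eq: "s = (i, xs, v)" by (rule prod_cases3)
      obtain x u where p_v: "p v = (x, u)" by (cases "p v")
      have "bitsize u \<le> bitsize v" using rest[of v] by (simp add: p_v)
      have "bitsize (x, u) \<le> a * Suc (bitsize v) ^ b" using size_le[of v] by (simp add: p_v)
      also have "\<dots> \<le> a * Suc (bitsize (w, y)) ^ b"
        using that by (intro mult_le_mono2 power_mono) (simp_all add: s_eq)
      finally show ?thesis
        using that \<open>bitsize u \<le> bitsize v\<close> bitsize_Suc_nat[of i]
        by (simp add: s_eq p_v decode_list_step_def)
    qed
  qed (unfold decode_list_step_def, simp_all add: bitsize_snd_decode_nat,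
      (intro polytime_intros polytime_comp[OF poly])+)
  then have "polytime (\<lambda>w. case fold (\<lambda>_. ?h w) w (0, [], snd (decode_nat w)) of (i, xs, u)
      \<Rightarrow> (rev xs, u))"
    by (intro polytime_intros)
  then show ?thesis
    by (simp add: decode_list_def[abs_def] case_prod_beta)
qed

definition decode_int :: "bool list \<Rightarrow> int \<times> bool list" where
  "decode_int w = (case w of
     [] \<Rightarrow> (0, [])
   | s # v \<Rightarrow> (case decode_nat v of (n, u) \<Rightarrow> (signed s n, u)))"

lemma decode_int_enc_int: "decode_int (enc_int i @ w) = (i, w)"
  by (simp add: decode_int_def enc_int_def decode_nat_enc_nat signed_def)

lemma bitsize_snd_decode_int: "bitsize (snd (decode_int w)) \<le> bitsize w"
proof (cases w)
  case (Cons b v)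
  then show ?thesis using bitsize_snd_decode_nat[of v] by (simp add: decode_int_def case_prod_beta)
qed (simp add: decode_int_def)

lemma polytime_decode_int: "polytime decode_int"
  unfolding decode_int_def[abs_def] by (intro polytime_intros)

definition decode_examples :: "bool list \<Rightarrow> int list list \<times> bool list" where
  "decode_examples = decode_list (decode_list decode_int)"

lemma decode_examples_enc: "decode_examples (enc_list (enc_list enc_int) es @ w) = (es, w)"
proof -
  have "enc_int i \<noteq> []" "enc_list enc_int is \<noteq> []" for i "is"
    by (simp_all add: enc_int_def enc_list_def enc_nat_def)
  then show ?thesis
    unfolding decode_examples_def by (intro decode_list_enc_list decode_int_enc_int)
qed

lemma polytime_decode_examples: "polytime decode_examples"
  unfolding decode_examples_def
  by (intro polytime_decode_list polytime_decode_int bitsize_snd_decode_list bitsize_snd_decode_int)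

definition decode_inst :: "bool list \<Rightarrow> ci \<times> nat" where
  "decode_inst w = (case decode_nat w of (n, w\<^sub>1) \<Rightarrow> case decode_examples w\<^sub>1 of (P, w\<^sub>2) \<Rightarrow>
     case decode_examples w\<^sub>2 of (N, w\<^sub>3) \<Rightarrow> (\<lparr>nfeat = n, pos = P, neg = N\<rparr>, fst (decode_nat w\<^sub>3)))"

lemma decode_inst_enc_inst: "decode_inst (enc_inst x) = x"
  using decode_nat_enc_nat[of "snd x" "[]"]
  by (cases x) (simp add: decode_inst_def enc_inst_def decode_nat_enc_nat decode_examples_enc)

lemma polytime_decode_inst: "polytime decode_inst"
  unfolding decode_inst_def[abs_def]
  by (intro polytime_intros polytime_comp[OF polytime_decode_examples])

theorem has_poly_kernelI:
  assumes "polytime \<kappa>"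
    and sound: "\<And>x. wf_ci (fst x) \<Longrightarrow> R (fst x) \<Longrightarrow> wf_ci (fst (\<kappa> x)) \<and> R (fst (\<kappa> x)) \<and> (P (\<kappa> x) \<longleftrightarrow> P x)"
    and size: "polybounded {x. wf_ci (fst x) \<and> R (fst x)} (\<lambda>x. length (enc_inst (\<kappa> x)))
        (\<lambda>x. k (fst x))"
  shows "has_poly_kernel P R k"
proof -
  have "polytime (\<lambda>w. enc_inst (\<kappa> (decode_inst w)))"
    by (intro polytime_comp[OF polytime_enc_inst] polytime_comp[OF assms(1)] polytime_decode_inst)
  then obtain M a b where "wf_tm M" and runs:
      "\<And>w. \<exists>t \<le> a * length w ^ b + a. tm_computes_within M w (enc_inst (\<kappa> (decode_inst w))) t"
    by (rule tm_computes_if_polytime) blast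
  moreover have "\<exists>t \<le> a * length (enc_inst x) ^ b + a.
      tm_computes_within M (enc_inst x) (enc_inst (\<kappa> x)) t" for x
    using runs[of "enc_inst x"] by (simp only: decode_inst_enc_inst)
  moreover obtain c d where "\<And>x. x \<in> {x. wf_ci (fst x) \<and> R (fst x)} \<Longrightarrow>
      length (enc_inst (\<kappa> x)) \<le> c * k (fst x) ^ d + c"
    using size by (rule polybounded_monomial) blast
  ultimately show ?thesis
    using sound unfolding has_poly_kernel_def mem_Collect_eq by metis
qed

section \<open>The kernel\<close>

subsection \<open>Relabelling the entries of an instance\<close>

definition entries :: "ci \<Rightarrow> int set" where
  "entries I = \<Union> (set ` examples I)"

lemma finite_entries: "finite (entries I)"
  by (simp add: entries_def examples_def)

lemma in_entriesI: "e \<in> examples I \<Longrightarrow> v \<in> set e \<Longrightarrow> v \<in> entries I"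
  by (auto simp: entries_def)

lemma ex_threshold_map:
  fixes \<rho> :: "'a::linorder \<Rightarrow> int"
  assumes "finite A" "strict_mono_on A \<rho>"
  shows "\<exists>g. \<forall>t. \<forall>v\<in>A. \<rho> v \<le> g t \<longleftrightarrow> v \<le> t"
proof (intro exI allI ballI)
  fix t v assume v: "v \<in> A"
  let ?below = "insert (Min (\<rho> ` A) - 1) (\<rho> ` {u \<in> A. u \<le> t})"
  have "Min (\<rho> ` A) \<le> \<rho> v" using assms(1) v by simp
  then have "\<rho> v \<le> Max ?below \<longleftrightarrow> (\<exists>u\<in>A. u \<le> t \<and> \<rho> v \<le> \<rho> u)"
    using assms(1) by (auto simp: Max_ge_iff)
  also have "\<dots> \<longleftrightarrow> v \<le> t"
    using strict_mono_on_less_eq[OF assms(2) v] v by (auto intro: order_trans)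
  finally show "\<rho> v \<le> Max ?below \<longleftrightarrow> v \<le> t" .
qed

primrec map_threshold :: "(int \<Rightarrow> int) \<Rightarrow> dt \<Rightarrow> dt" where
  "map_threshold g (Leaf b) = Leaf b"
| "map_threshold g (Node f t l r) = Node f (g t) (map_threshold g l) (map_threshold g r)"

lemma map_threshold_simps [simp]:
  "dt_size (map_threshold g T) = dt_size T" "dt_depth (map_threshold g T) = dt_depth T"
  "dt_feats (map_threshold g T) = dt_feats T"
  by (induction T) simp_all

lemma dt_eval_map_threshold:
  assumes "\<And>t v. v \<in> set e \<Longrightarrow> \<rho> v \<le> g t \<longleftrightarrow> v \<le> t" "\<forall>f\<in>dt_feats T. f < length e"
  shows "dt_eval (map_threshold g T) (map \<rho> e) = dt_eval T e"
  using assms by (induction T) auto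

lemma delta_max_eq_Max_image:
  "delta_max I = Max (insert 0 ((\<lambda>(p, q). card (diff_feats I p q)) ` (set (pos I) \<times> set (neg I))))"
  unfolding delta_max_def by (rule arg_cong[where f = "\<lambda>A. Max (insert 0 A)"]) auto

locale relabelling =
  fixes \<rho> :: "int \<Rightarrow> int" and I J :: ci
  assumes wf: "wf_ci I" and mono: "strict_mono_on (entries I) \<rho>"
    and nfeat_eq: "nfeat J = nfeat I"
    and set_pos: "set (pos J) = map \<rho> ` set (pos I)"
    and set_neg: "set (neg J) = map \<rho> ` set (neg I)"
begin

lemma examples_eq: "examples J = map \<rho> ` examples I"
  by (auto simp: examples_def set_pos set_neg)

lemma inj: "inj_on \<rho> (entries I)"
  using mono by (rule strict_mono_on_imp_inj_on)

lemma inj_map: "inj_on (map \<rho>) (examples I)"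
  using inj by (intro inj_on_mapI) (simp add: entries_def)

lemma wf_ci_relabelled: "wf_ci J"
proof -
  have "set (pos J) \<inter> set (neg J) = map \<rho> ` (set (pos I) \<inter> set (neg I))"
    unfolding set_pos set_neg by (rule inj_on_image_Int[OF inj_map, symmetric])
      (auto simp: examples_def)
  then show ?thesis
    using wf by (auto simp: wf_ci_def examples_eq nfeat_eq)
qed

lemma diff_feats_relabelled:
  assumes "e \<in> examples I" "e' \<in> examples I"
  shows "diff_feats J (map \<rho> e) (map \<rho> e') = diff_feats I e e'"
proof -
  have "length e = nfeat I" "length e' = nfeat I"
    using wf assms by (auto simp: wf_ci_def)
  moreover from this have "\<rho> (e ! f) = \<rho> (e' ! f) \<longleftrightarrow> e ! f = e' ! f" if "f < nfeat I" for f
    using that assms by (intro inj_on_eq_iff[OF inj]) (auto intro: in_entriesI)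
  ultimately show ?thesis
    by (auto simp: diff_feats_def nfeat_eq)
qed

lemma delta_max_relabelled: "delta_max J = delta_max I"
proof -
  have "(\<lambda>(p, q). card (diff_feats J p q)) ` (set (pos J) \<times> set (neg J))
      = (\<lambda>(p, q). card (diff_feats I p q)) ` (set (pos I) \<times> set (neg I))"
    by (force simp: set_pos set_neg image_def diff_feats_relabelled examples_def)
  then show ?thesis by (simp add: delta_max_eq_Max_image)
qed

lemma classifies_relabelled:
  assumes "classifies T I"
  obtains g where "classifies (map_threshold g T) J"
proof -
  obtain g where thresholds: "\<And>t v. v \<in> entries I \<Longrightarrow> \<rho> v \<le> g t \<longleftrightarrow> v \<le> t"
    using ex_threshold_map[OF finite_entries mono] by blast
  have "dt_eval (map_threshold g T) (map \<rho> e) = dt_eval T e" if "e \<in> examples I" for e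
    using thresholds that wf assms
    by (intro dt_eval_map_threshold) (auto simp: entries_def wf_ci_def classifies_def)
  then have "classifies (map_threshold g T) J"
    using assms by (auto simp: classifies_def nfeat_eq set_pos set_neg examples_def)
  then show thesis by (rule that)
qed

lemma relabelling_inv: "relabelling (inv_into (entries I) \<rho>) J I"
proof
  let ?\<sigma> = "inv_into (entries I) \<rho>"
  have entries: "entries J = \<rho> ` entries I"
    by (auto simp: entries_def examples_eq)
  show "strict_mono_on (entries J) ?\<sigma>"
    unfolding entries
    by (rule strict_mono_onI) (auto simp: inj strict_mono_on_less[OF mono])
  have "map ?\<sigma> (map \<rho> e) = e" if "e \<in> examples I" for e
    using in_entriesI[OF that] inj by (auto intro!: map_idI)
  then show "set (pos I) = map ?\<sigma> ` set (pos J)" "set (neg I) = map ?\<sigma> ` set (neg J)"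
    by (auto simp: set_pos set_neg image_image examples_def)
qed (simp_all add: wf_ci_relabelled nfeat_eq)

end

subsection \<open>Consistent instances have decision trees\<close>

primrec match_dt :: "int list \<Rightarrow> dt \<Rightarrow> nat list \<Rightarrow> dt" where
  "match_dt e T [] = Leaf True"
| "match_dt e T (f # fs) = Node f (e ! f) (Node f (e ! f - 1) T (match_dt e T fs)) T"

lemma
  shows dt_eval_match_dt: "dt_eval (match_dt e T fs) x \<longleftrightarrow> (\<forall>f\<in>set fs. x ! f = e ! f) \<or> dt_eval T x"
    and dt_depth_match_dt: "dt_depth (match_dt e T fs) \<le> 2 * length fs + dt_depth T"
    and dt_feats_match_dt: "dt_feats (match_dt e T fs) \<subseteq> set fs \<union> dt_feats T"
  by (induction fs) auto

primrec member_dt :: "int list list \<Rightarrow> dt" where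
  "member_dt [] = Leaf False"
| "member_dt (e # es) = match_dt e (member_dt es) [0..<length e]"

lemma dt_eval_member_dt:
  assumes "\<forall>e\<in>set es. length e = length x"
  shows "dt_eval (member_dt es) x \<longleftrightarrow> x \<in> set es"
  using assms
proof (induction es)
  case (Cons e es)
  have "length e = length x" using Cons.prems by simp
  then have "(\<forall>f\<in>set [0..<length e]. x ! f = e ! f) \<longleftrightarrow> x = e"
    unfolding list_eq_iff_nth_eq by auto
  moreover have "dt_eval (member_dt es) x \<longleftrightarrow> x \<in> set es" using Cons by simp
  ultimately show ?case unfolding member_dt.simps dt_eval_match_dt by simp
qed simp

lemma dt_depth_member_dt: "dt_depth (member_dt es) \<le> length (concat (es @ es))"
proof (induction es)
  case (Cons e es)
  then show ?case using dt_depth_match_dt[of e "member_dt es" "[0..<length e]"] by simp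
qed simp

lemma dt_feats_member_dt: "\<forall>e\<in>set es. length e = n \<Longrightarrow> dt_feats (member_dt es) \<subseteq> {..<n}"
proof (induction es)
  case (Cons e es)
  then show ?case using dt_feats_match_dt[of e "member_dt es" "[0..<length e]"] by auto
qed simp

lemma classifies_member_dt:
  assumes "wf_ci I" "set es = set (pos I)"
  shows "classifies (member_dt es) I"
proof -
  have "\<forall>e\<in>set es. length e = nfeat I"
    using assms by (auto simp: wf_ci_def examples_def)
  then show ?thesis
    using assms dt_feats_member_dt[of es "nfeat I"] dt_eval_member_dt[of es]
    by (auto simp: classifies_def wf_ci_def examples_def)
qed

lemma dt_size_le: "dt_size T \<le> 2 ^ dt_depth T"
proof -
  have "dt_size T < 2 ^ dt_depth T"
  proof (induction T)
    case (Node f t l r)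
    let ?d = "max (dt_depth l) (dt_depth r)"
    have "dt_size l < 2 ^ ?d" "dt_size r < 2 ^ ?d"
      by (rule less_le_trans[OF Node.IH(1)] less_le_trans[OF Node.IH(2)];
          simp add: power_increasing)+
    then show ?case by simp
  qed simp
  then show ?thesis by simp
qed

subsection \<open>Counting examples\<close>

lemma sum_powers_le: "(\<Sum>i\<le>k. a ^ i) \<le> Suc a ^ k"
proof (induction k)
  case (Suc k)
  have "a ^ Suc k \<le> a * Suc a ^ k" by (simp add: power_mono del: mult_le_cancel1)
  with Suc have "(\<Sum>i\<le>Suc k. a ^ i) \<le> Suc a ^ k + a * Suc a ^ k"
    unfolding sum.atMost_Suc by (rule add_mono)
  then show ?case by simp
qed simp

lemma card_hamming_ball_le:
  fixes V :: "nat \<Rightarrow> 'a set"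
  assumes V: "\<And>f. f < n \<Longrightarrow> finite (V f) \<and> card (V f) \<le> d"
    and B: "\<And>e. e \<in> B \<Longrightarrow> length e = n \<and> (\<forall>f<n. e ! f \<in> V f) \<and> card {f. f < n \<and> e ! f \<noteq> q ! f} \<le> k"
  shows "card B \<le> (1 + n * d) ^ k"
proof -
  let ?U = "SIGMA f:{..<n}. V f"
  define diffs where "diffs e = map (\<lambda>f. (f, e ! f)) (filter (\<lambda>f. e ! f \<noteq> q ! f) [0..<n])" for e
  have finite_U: "finite ?U" using V by auto
  have "card ?U = (\<Sum>f<n. card (V f))" using V by (subst card_SigmaI) auto
  also have "\<dots> \<le> (\<Sum>f<n. d)" using V by (intro sum_mono) simp
  finally have card_U: "card ?U \<le> n * d" by simp
  have "inj_on diffs B"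
  proof (rule inj_onI)
    fix e e' assume e: "e \<in> B" "e' \<in> B" "diffs e = diffs e'"
    have diffs: "(f, v) \<in> set (diffs e) \<longleftrightarrow> f < n \<and> v = e ! f \<and> v \<noteq> q ! f" for e f v
      by (auto simp: diffs_def)
    have "e ! f = e' ! f" if "f < n" for f
      using that e(3) diffs[of f "e ! f" e] diffs[of f "e ! f" e']
        diffs[of f "e' ! f" e] diffs[of f "e' ! f" e']
      by auto
    then show "e = e'" using B e by (auto simp: list_eq_iff_nth_eq)
  qed
  moreover have "diffs ` B \<subseteq> {us. set us \<subseteq> ?U \<and> length us \<le> k}"
  proof -
    have "length (diffs e) = card {f. f < n \<and> e ! f \<noteq> q ! f}" for e
      by (auto simp: diffs_def length_filter_conv_card intro!: arg_cong[where f = card])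
    then show ?thesis using B by (auto simp: diffs_def)
  qed
  ultimately have "card B \<le> card {us. set us \<subseteq> ?U \<and> length us \<le> k}"
    using finite_lists_length_le[OF finite_U] by (rule card_inj_on_le)
  also have "\<dots> \<le> Suc (card ?U) ^ k"
    unfolding card_lists_length_le[OF finite_U] by (rule sum_powers_le)
  also have "\<dots> \<le> (1 + n * d) ^ k"
    using card_U by (intro power_mono) simp_all
  finally show ?thesis .
qed

lemma card_values_le_D_max: "f < nfeat I \<Longrightarrow> card {e ! f | e. e \<in> examples I} \<le> D_max I"
  unfolding D_max_def by (rule Max_ge) (auto simp: setcompr_eq_image[of _ "\<lambda>f. f < nfeat I"])

lemma delta_max_le_iff:
  "delta_max I \<le> c \<longleftrightarrow> (\<forall>p\<in>set (pos I). \<forall>q\<in>set (neg I). card (diff_feats I p q) \<le> c)"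
  unfolding delta_max_eq_Max_image by auto

lemma card_near_examples:
  assumes "wf_ci I" "S \<subseteq> examples I" "\<And>e. e \<in> S \<Longrightarrow> card (diff_feats I e q) \<le> c"
  shows "card S \<le> (1 + nfeat I * D_max I) ^ c"
proof (rule card_hamming_ball_le)
  show "finite {e ! f | e. e \<in> examples I} \<and> card {e ! f | e. e \<in> examples I} \<le> D_max I"
      if "f < nfeat I" for f
    using card_values_le_D_max[OF that] by (simp add: setcompr_eq_image examples_def)
  show "length e = nfeat I \<and> (\<forall>f<nfeat I. e ! f \<in> {e ! f | e. e \<in> examples I})
      \<and> card {f. f < nfeat I \<and> e ! f \<noteq> q ! f} \<le> c"
    if "e \<in> S" for e
    using that assms by (auto simp: wf_ci_def diff_feats_def)
qed

lemma card_pos_neg_le: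
  assumes "wf_ci I" "delta_max I \<le> c" "pos I \<noteq> []" "neg I \<noteq> []"
  shows "card (set (pos I)) \<le> (1 + nfeat I * D_max I) ^ c"
    and "card (set (neg I)) \<le> (1 + nfeat I * D_max I) ^ c"
proof -
  obtain p q where members: "p \<in> set (pos I)" "q \<in> set (neg I)"
    using assms(3,4) by (meson ex_in_conv set_empty)
  have commute: "diff_feats I e e' = diff_feats I e' e" for e e'
    by (auto simp: diff_feats_def)
  show "card (set (pos I)) \<le> (1 + nfeat I * D_max I) ^ c"
    by (rule card_near_examples[where q = q])
      (use assms members in \<open>auto simp: examples_def delta_max_le_iff\<close>)
  show "card (set (neg I)) \<le> (1 + nfeat I * D_max I) ^ c"
    by (rule card_near_examples[where q = p])
      (use assms members in \<open>auto simp: examples_def delta_max_le_iff commute[of _ p]\<close>)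
qed

subsection \<open>Compression\<close>

definition rank :: "int list \<Rightarrow> int \<Rightarrow> int" where
  "rank A v = int (length (filter (\<lambda>u. u < v) A))"

lemma strict_mono_on_rank: "strict_mono_on (set A) (rank A)"
proof (rule strict_mono_onI)
  fix u v assume uv: "u \<in> set A" "u < v"
  have "filter (\<lambda>a. a < u) A = filter (\<lambda>a. a < u) (filter (\<lambda>a. a < v) A)"
    unfolding filter_filter using uv(2) by (intro filter_cong) auto
  moreover have "length (filter (\<lambda>a. a < u) (filter (\<lambda>a. a < v) A)) < length (filter (\<lambda>a. a < v) A)"
    using uv by (intro length_filter_less[of u]) simp_all
  ultimately show "rank A u < rank A v" by (simp add: rank_def)
qed

definition compress :: "ci \<Rightarrow> ci" where
  "compress I = (let P = remdups (pos I); N = remdups (neg I); \<rho> = rank (concat (P @ N))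
     in \<lparr>nfeat = nfeat I, pos = map (map \<rho>) P, neg = map (map \<rho>) N\<rparr>)"

lemma relabelling_compress:
  assumes "wf_ci I"
  shows "relabelling (rank (concat (remdups (pos I) @ remdups (neg I)))) I (compress I)"
proof
  have "entries I = set (concat (remdups (pos I) @ remdups (neg I)))"
    by (auto simp: entries_def examples_def)
  then show "strict_mono_on (entries I) (rank (concat (remdups (pos I) @ remdups (neg I))))"
    by (simp only: strict_mono_on_rank)
qed (simp_all add: assms compress_def Let_def)

definition kernel :: "ci \<times> nat \<Rightarrow> ci \<times> nat" where
  "kernel = (\<lambda>(I, s). if pos I = [] \<or> neg I = [] then (\<lparr>nfeat = 0, pos = [], neg = []\<rparr>, 0)
     else let J = compress I in (J, min s (2 ^ length (concat (pos J @ pos J)))))"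

lemma polytime_rank:
  assumes "polytime f" "polytime g"
  shows "polytime (\<lambda>x. rank (f x) (g x))"
  unfolding rank_def
  by (intro polytime_intros assms polytime_comp[OF assms(2)])

lemma polytime_compress: "polytime compress"
  unfolding compress_def[abs_def] by (intro polytime_intros polytime_rank)

lemma polytime_kernel: "polytime kernel"
  unfolding kernel_def
  by (intro polytime_intros polytime_two_power_length polytime_comp[OF polytime_compress])

locale dt_measure =
  fixes \<mu> :: "dt \<Rightarrow> nat"
  assumes Leaf_eq_0: "\<mu> (Leaf b) = 0"
    and le_two_power_depth: "\<mu> T \<le> 2 ^ dt_depth T"
    and map_threshold_eq: "\<mu> (map_threshold g T) = \<mu> T"
begin

definition solvable :: "ci \<times> nat \<Rightarrow> bool" where
  "solvable x \<longleftrightarrow> (\<exists>T. classifies T (fst x) \<and> \<mu> T \<le> snd x)"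

lemma solvable_if_one_class: "pos I = [] \<or> neg I = [] \<Longrightarrow> solvable (I, s)"
  unfolding solvable_def
  by (rule exI[of _ "Leaf (neg I = [])"]) (auto simp: classifies_def Leaf_eq_0)

lemma solvable_if_large_budget:
  assumes "wf_ci I" "set es = set (pos I)" "2 ^ length (concat (es @ es)) \<le> s"
  shows "solvable (I, s)"
proof -
  have "\<mu> (member_dt es) \<le> 2 ^ dt_depth (member_dt es)" by (rule le_two_power_depth)
  also have "\<dots> \<le> 2 ^ length (concat (es @ es))"
    by (intro power_increasing dt_depth_member_dt) simp
  finally show ?thesis
    using classifies_member_dt[OF assms(1,2)] assms(3) unfolding solvable_def by auto
qed

lemma solvable_relabelling:
  assumes "relabelling \<rho> I J"
  shows "solvable (J, s) \<longleftrightarrow> solvable (I, s)"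
  using relabelling.classifies_relabelled[OF assms]
    relabelling.classifies_relabelled[OF relabelling.relabelling_inv[OF assms]] map_threshold_eq
  unfolding solvable_def fst_conv snd_conv by metis

lemma solvable_min_budget:
  assumes "wf_ci I" "set es = set (pos I)"
  shows "solvable (I, min s (2 ^ length (concat (es @ es)))) \<longleftrightarrow> solvable (I, s)"
proof (cases "s \<le> 2 ^ length (concat (es @ es))")
  case False
  then show ?thesis
    using solvable_if_large_budget[OF assms] by simp
qed (simp add: min_absorb1)

lemma solvable_kernel:
  assumes "wf_ci (fst x)"
  shows "wf_ci (fst (kernel x)) \<and> delta_max (fst (kernel x)) \<le> delta_max (fst x)
      \<and> (solvable (kernel x) \<longleftrightarrow> solvable x)"
proof -
  obtain I s where x_eq: "x = (I, s)" by (cases x)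
  show ?thesis
  proof (cases "pos I = [] \<or> neg I = []")
    case True
    then have "kernel x = (\<lparr>nfeat = 0, pos = [], neg = []\<rparr>, 0)"
      by (simp add: x_eq kernel_def)
    with True show ?thesis
      by (simp add: x_eq solvable_if_one_class wf_ci_def examples_def delta_max_le_iff)
  next
    case False
    let ?J = "compress I"
    interpret relabelling "rank (concat (remdups (pos I) @ remdups (neg I)))" I ?J
      using assms by (intro relabelling_compress) (simp add: x_eq)
    have "kernel x = (?J, min s (2 ^ length (concat (pos ?J @ pos ?J))))"
      using False by (simp add: x_eq kernel_def Let_def)
    then show ?thesis
      using solvable_min_budget[OF wf_ci_relabelled refl]
        solvable_relabelling[OF relabelling_axioms]
      by (simp add: x_eq wf_ci_relabelled delta_max_relabelled del: concat_append)
  qed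
qed

end

subsection \<open>Size of the kernel\<close>

lemma length_bin_le: "length (bin n) \<le> n"
  by (simp add: length_bin_le_iff)

lemma length_enc_nat: "length (enc_nat n) = 2 * length (bin n) + 2"
proof -
  have "length (concat (map (\<lambda>b. [b, b]) bs)) = 2 * length bs" for bs :: "bool list"
    by (induction bs) auto
  then show ?thesis by (simp add: enc_nat_def)
qed

lemma length_concat_le:
  assumes "\<And>xs. xs \<in> set xss \<Longrightarrow> length xs \<le> k"
  shows "length (concat xss) \<le> length xss * k"
  using assms by (induction xss) (auto simp: add_mono)

lemma length_enc_list_le:
  assumes "\<And>x. x \<in> set xs \<Longrightarrow> length (e x) \<le> k" "length xs \<le> n"
  shows "length (enc_list e xs) \<le> 2 * n + 2 + n * k"
proof -
  have "length (concat (map e xs)) \<le> length xs * k"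
    using length_concat_le[of "map e xs" k] assms(1) by auto
  also have "\<dots> \<le> n * k" using assms(2) by simp
  finally show ?thesis
    using length_bin_le[of "length xs"] assms(2) by (simp add: enc_list_def length_enc_nat)
qed

lemma length_enc_rank_le: "length (enc_int (rank A v)) \<le> 2 * length A + 3"
  using le_trans[OF length_bin_le length_filter_le[of "\<lambda>u. u < v" A]]
  by (simp add: enc_int_def rank_def length_enc_nat)

lemma length_enc_ranked_examples_le:
  assumes "length A \<le> m" "\<And>e. e \<in> set es \<Longrightarrow> length e \<le> k" "length es \<le> n"
  shows "length (enc_list (enc_list enc_int) (map (map (rank A)) es))
    \<le> 2 * n + 2 + n * (2 * k + 2 + k * (2 * m + 3))"
proof (rule length_enc_list_le)
  fix e assume "e \<in> set (map (map (rank A)) es)"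
  then obtain e' where "e' \<in> set es" "e = map (rank A) e'" by auto
  moreover have "length (enc_int (rank A v)) \<le> 2 * m + 3" for v
    using length_enc_rank_le[of A v] assms(1) by simp
  ultimately show "length (enc_list enc_int e) \<le> 2 * k + 2 + k * (2 * m + 3)"
    using assms(2)[of e'] by (intro length_enc_list_le) auto
qed (use assms in simp)

lemma length_bin_min_le:
  assumes "l \<le> m"
  shows "length (bin (min s (2 ^ l))) \<le> m + 1"
proof -
  have "(2::nat) ^ l < 2 ^ (m + 1)" using assms by (intro power_strict_increasing) auto
  then show ?thesis unfolding length_bin_le_iff min_less_iff_disj by simp
qed

definition kernel_bound :: "nat \<Rightarrow> nat \<Rightarrow> nat" where
  "kernel_bound c k =
    (let g = (1 + k * k) ^ c; m = 2 * g * k; l = 2 * g + 2 + g * (2 * k + 2 + k * (2 * m + 3))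
     in (2 * k + 2) + l + l + (2 * (m + 1) + 2))"

lemma length_remdups_pos_neg_le:
  assumes "wf_ci I" "delta_max I \<le> c" "pos I \<noteq> []" "neg I \<noteq> []"
  shows "length (remdups (pos I)) \<le> (1 + param I * param I) ^ c"
    and "length (remdups (neg I)) \<le> (1 + param I * param I) ^ c"
proof -
  have "(1 + nfeat I * D_max I) ^ c \<le> (1 + param I * param I) ^ c"
    unfolding param_def by (intro power_mono add_left_mono mult_mono) auto
  then show "length (remdups (pos I)) \<le> (1 + param I * param I) ^ c"
    "length (remdups (neg I)) \<le> (1 + param I * param I) ^ c"
    using card_pos_neg_le[OF assms] by (simp_all add: length_remdups_card_conv)
qed

lemma length_enc_kernel_le:
  assumes wf: "wf_ci I" and delta: "delta_max I \<le> c"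
  shows "length (enc_inst (kernel (I, s))) \<le> kernel_bound c (param I)"
proof (cases "pos I = [] \<or> neg I = []")
  case True
  then show ?thesis
    by (simp add: kernel_def enc_inst_def enc_list_def enc_nat_def kernel_bound_def Let_def)
next
  case False
  define k where "k = param I"
  define g where "g = (1 + k * k) ^ c"
  define m where "m = 2 * g * k"
  define l where "l = 2 * g + 2 + g * (2 * k + 2 + k * (2 * m + 3))"
  define P N where "P = remdups (pos I)" and "N = remdups (neg I)"
  have nfeat_le: "nfeat I \<le> k" by (simp add: k_def param_def)
  have card: "length P \<le> g" "length N \<le> g"
    using length_remdups_pos_neg_le[OF wf delta] False by (auto simp: P_def N_def g_def k_def)
  have length_example: "length e \<le> k" if "e \<in> set (P @ N)" for e
    using that wf nfeat_le by (auto simp: P_def N_def wf_ci_def examples_def)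
  have entries: "length (concat (X @ Y)) \<le> m"
    if "length X \<le> g" "length Y \<le> g" "set (X @ Y) \<subseteq> set (P @ N)" for X Y
  proof -
    have "length (concat (X @ Y)) \<le> length (X @ Y) * k"
      by (rule length_concat_le) (use that length_example in blast)
    also have "\<dots> \<le> m" unfolding m_def using that by (intro mult_right_mono) simp_all
    finally show ?thesis .
  qed
  let ?\<rho> = "rank (concat (P @ N))"
  have lists: "length (enc_list (enc_list enc_int) (map (map ?\<rho>) X)) \<le> l"
    if "length X \<le> g" "set X \<subseteq> set (P @ N)" for X
    unfolding l_def using entries[of P N] card that length_example
    by (intro length_enc_ranked_examples_le) auto
  have "length (bin (min s (2 ^ length (concat (P @ P))))) \<le> m + 1"
    using entries[of P P] card by (intro length_bin_min_le) auto
  moreover have "length (bin (nfeat I)) \<le> k" using length_bin_le[of "nfeat I"] nfeat_le by simp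
  moreover have "kernel (I, s) = (\<lparr>nfeat = nfeat I, pos = map (map ?\<rho>) P, neg = map (map ?\<rho>) N\<rparr>,
      min s (2 ^ length (concat (P @ P))))"
    using False by (simp add: kernel_def compress_def Let_def P_def N_def length_concat comp_def)
  ultimately have "length (enc_inst (kernel (I, s))) \<le> (2 * k + 2) + l + l + (2 * (m + 1) + 2)"
    using lists[of P] lists[of N] card by (simp add: enc_inst_def length_enc_nat)
  then show ?thesis by (simp only: kernel_bound_def Let_def k_def g_def m_def l_def)
qed

lemma polybounded_length_enc_kernel:
  "polybounded {x. wf_ci (fst x) \<and> delta_max (fst x) \<le> c} (\<lambda>x. length (enc_inst (kernel x)))
    (\<lambda>x. param (fst x))"
proof (rule polybounded_mono)
  show "polybounded {x. wf_ci (fst x) \<and> delta_max (fst x) \<le> c} (\<lambda>x. kernel_bound c (param (fst x)))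
      (\<lambda>x. param (fst x))"
    unfolding kernel_bound_def Let_def by (intro polybounded_intros)
qed (use length_enc_kernel_le in \<open>auto simp: split_paired_all\<close>)

theorem (in dt_measure) has_poly_kernel_solvable:
  "has_poly_kernel solvable (\<lambda>I. delta_max I \<le> c) param"
  using solvable_kernel le_trans
  by (intro has_poly_kernelI[OF polytime_kernel _ polybounded_length_enc_kernel]) blast

theorem theorem3:
  fixes c :: nat
  shows "has_poly_kernel DTS (\<lambda>I. delta_max I \<le> c) param
       \<and> has_poly_kernel DTD (\<lambda>I. delta_max I \<le> c) param"
proof
  interpret size: dt_measure dt_size
    by standard (simp_all add: dt_size_le)
  have "DTS = size.solvable" by (simp add: fun_eq_iff DTS_def size.solvable_def)
  then show "has_poly_kernel DTS (\<lambda>I. delta_max I \<le> c) param"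
    using size.has_poly_kernel_solvable by simp
  interpret depth: dt_measure dt_depth
    by standard (simp_all add: less_imp_le[OF less_exp])
  have "DTD = depth.solvable" by (simp add: fun_eq_iff DTD_def depth.solvable_def)
  then show "has_poly_kernel DTD (\<lambda>I. delta_max I \<le> c) param"
    using depth.has_poly_kernel_solvable by simp
qed

end
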